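(* For every non-increasing sequence $\tau:\mathbb N\to(0,\infty)$ with $\tau(n)\to0$ there exist a topological dynamical system $(X,T)$ with zero topological entropy and a real-valued $f\in\mathcal C(X)$ such that: (1) for every real sequence $(a_n)_{n\ge1}$ with $|a_n|\le1$ and $\limsup_{N\to\infty}\frac1N\sum_{n=1}^N|a_n|>0$ there is $x\in X$ with $$\limsup_{N\to\infty}\frac{\frac1N\sum_{n=1}^N f(T^nx)a_n}{\tau(N)}>0;$$ (2) $(X,T)$ satisfies Sarnak's conjecture: $\frac1N\sum_{n=1}^N\mu(n)g(T^nx)\to0$ as $N\to\infty$ for every $g\in\mathcal C(X)$ and every $x\in X$.
   Context: A topological dynamical system $(X,T)$ consists of a compact metric space $X$ and a continuous map $T:X\to X$; topological entropy is the usual (Bowen–Dinaburg) topological entropy. $\mu$ denotes the Möbius function. *)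

theory Defs
  imports "HOL-Analysis.Analysis" "HOL-Computational_Algebra.Squarefree"
begin

definition moebius :: "nat \<Rightarrow> real" where
  "moebius n = (if n = 0 \<or> \<not> squarefree n then 0 else (-1) ^ card (prime_factors n))"

definition separated_set ::
  "'a::metric_space set \<Rightarrow> ('a \<Rightarrow> 'a) \<Rightarrow> nat \<Rightarrow> real \<Rightarrow> 'a set \<Rightarrow> bool" where
  "separated_set X T n eps E \<longleftrightarrow> E \<subseteq> X \<and>
     (\<forall>x\<in>E. \<forall>y\<in>E. x \<noteq> y \<longrightarrow> (\<exists>k<n. dist ((T ^^ k) x) ((T ^^ k) y) > eps))"

definition max_separated ::
  "'a::metric_space set \<Rightarrow> ('a \<Rightarrow> 'a) \<Rightarrow> nat \<Rightarrow> real \<Rightarrow> real" where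
  "max_separated X T n eps = Sup {real (card E) | E. finite E \<and> separated_set X T n eps E}"

text \<open>Topological entropy: limit as eps tends to 0 (equivalently, by monotonicity in eps,
  the supremum over eps > 0) of the exponential growth rate of maximal separated sets.\<close>
definition topological_entropy :: "'a::metric_space set \<Rightarrow> ('a \<Rightarrow> 'a) \<Rightarrow> ereal" where
  "topological_entropy X T =
     (SUP eps\<in>{0<..}. limsup (\<lambda>n. ereal (ln (max_separated X T n eps) / real n)))"

end

theory Submission
  imports Defs "HOL-Complex_Analysis.Complex_Analysis" "HOL-Real_Asymp.Real_Asymp"
begin

text \<open>
  Let \<open>X\<close> be the set of sequences with \<open>\<bar>x n\<bar> \<le> \<tau> n\<close> for all \<open>n\<close>, \<open>T\<close> the shift and \<open>f x = x 0\<close>. Since \<open>\<tau>\<close>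
  is non-increasing, \<open>X\<close> is shift invariant, and since \<open>\<tau> \<longlonglongrightarrow> 0\<close> all orbits converge uniformly to the
  fixed point \<open>0\<close>; hence the entropy vanishes, and \<open>x n = \<tau> n * sgn (a n)\<close> satisfies
  \<open>(\<Sum>n=1..N. x n * a n) \<ge> \<tau> N * (\<Sum>n=1..N. \<bar>a n\<bar>)\<close>. Sarnak's conjecture for \<open>(X, T)\<close> amounts to
  \<open>(\<Sum>n=1..N. \<mu> n) / N \<longlonglongrightarrow> 0\<close>, a form of the prime number theorem. It is obtained by Newman's method:
  \<open>\<Sum>n. \<mu> n / n powr s = 1 / \<zeta> s\<close> extends holomorphically across \<open>Re s = 1\<close> because \<open>\<zeta>\<close> has no zeros
  there, so \<open>\<Sum>n. \<mu> n / n\<close> converges, and Kronecker's lemma applies.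
\<close>

subsection \<open>Cesaro means\<close>

lemma cesaro_mean_tendsto_0:
  fixes c :: "nat \<Rightarrow> 'a::real_normed_field"
  assumes "c \<longlonglongrightarrow> 0"
  shows "(\<lambda>N. (\<Sum>n=1..N. c n) / of_nat N) \<longlonglongrightarrow> 0"
proof (rule LIMSEQ_I)
  fix e :: real assume e: "e > 0"
  obtain K where K: "\<And>n. n \<ge> K \<Longrightarrow> norm (c n) < e / 2"
    using LIMSEQ_D[OF assms, of "e/2"] e by auto
  define S where "S = (\<Sum>n=1..K. norm (c n))"
  \<comment> \<open>\<open>M\<close> is chosen so that the fixed head \<open>S\<close> falls below
    \<open>N * e / 2\<close> once \<open>N \<ge> M\<close>.\<close>
  obtain M :: nat where M: "real M > 2 * S / e"
    using reals_Archimedean2 by blast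
  have "norm ((\<Sum>n=1..N. c n) / of_nat N - 0) < e" if N: "N \<ge> max (Suc K) M" for N
  proof -
    have pos: "real N > 0" using N by linarith
    have "norm (\<Sum>n=1..N. c n) \<le> (\<Sum>n=1..N. norm (c n))" by (rule norm_sum)
    also have "\<dots> = S + (\<Sum>n\<in>{K<..N}. norm (c n))"
    proof -
      have "{1..N} = {1..K} \<union> {K<..N}" using N by auto
      then show ?thesis unfolding S_def by (subst sum.union_disjoint[symmetric]) auto
    qed
    also have "(\<Sum>n\<in>{K<..N}. norm (c n)) \<le> (\<Sum>n\<in>{K<..N}. e / 2)"
      by (intro sum_mono less_imp_le K) auto
    also have "(\<Sum>n\<in>{K<..N}. e / 2) \<le> real N * (e / 2)"
      using e by (simp add: mult_right_mono)
    also have "S < real N * (e / 2)"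
    proof -
      have "2 * S / e < real N" using M N by (meson less_le_trans max.boundedE of_nat_le_iff)
      then show ?thesis using e by (simp add: field_simps)
    qed
    finally have "norm (\<Sum>n=1..N. c n) < real N * e" by (simp add: mult.commute)
    then show ?thesis using pos by (simp add: norm_divide field_simps)
  qed
  then show "\<exists>no. \<forall>n\<ge>no. norm ((\<Sum>n=1..n. c n) / of_nat n - 0) < e" by blast
qed

lemma cesaro_mean_tendsto:
  fixes c :: "nat \<Rightarrow> 'a::real_normed_field"
  assumes "c \<longlonglongrightarrow> L"
  shows "(\<lambda>N. (\<Sum>n=1..N. c n) / of_nat N) \<longlonglongrightarrow> L"
proof -
  have "(\<lambda>N. (\<Sum>n=1..N. c n - L) / of_nat N) \<longlonglongrightarrow> 0"
    using assms by (intro cesaro_mean_tendsto_0) (simp add: LIM_zero)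
  then have "(\<lambda>N. (\<Sum>n=1..N. c n - L) / of_nat N + L) \<longlonglongrightarrow> 0 + L"
    by (intro tendsto_intros)
  moreover have "\<forall>\<^sub>F N in sequentially. (\<Sum>n=1..N. c n - L) / of_nat N + L = (\<Sum>n=1..N. c n) / of_nat N"
    using eventually_gt_at_top[of 0]
    by eventually_elim (simp add: sum_subtractf field_simps)
  ultimately show ?thesis by (simp add: Lim_transform_eventually)
qed

text \<open>Split \<open>b n\<close> as \<open>(b n - L) + L\<close>: bounded weights times a null
  sequence have mean tending to 0, and the constant \<open>L\<close> sees only the mean of
  \<open>w\<close>. Later \<open>w\<close> is the Moebius function and \<open>b\<close> an
  observable along a convergent orbit.\<close>

lemma cesaro_mean_mult_tendsto_0:
  fixes w b :: "nat \<Rightarrow> 'a::real_normed_field"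
  assumes w: "(\<lambda>N. (\<Sum>n=1..N. w n) / of_nat N) \<longlonglongrightarrow> 0"
    and bound: "\<And>n. norm (w n) \<le> 1" and b: "b \<longlonglongrightarrow> L"
  shows "(\<lambda>N. (\<Sum>n=1..N. w n * b n) / of_nat N) \<longlonglongrightarrow> 0"
proof -
  have "(\<lambda>n. w n * (b n - L)) \<longlonglongrightarrow> 0"
  proof (rule Lim_null_comparison)
    show "\<forall>\<^sub>F n in sequentially. norm (w n * (b n - L)) \<le> norm (b n - L)"
      using bound by (auto simp: norm_mult mult_left_le_one_le)
    show "(\<lambda>n. norm (b n - L)) \<longlonglongrightarrow> 0"
      using b by (simp add: LIM_zero tendsto_norm_zero)
  qed
  from cesaro_mean_tendsto_0[OF this]
  have "(\<lambda>N. (\<Sum>n=1..N. w n * (b n - L)) / of_nat N + L * ((\<Sum>n=1..N. w n) / of_nat N)) \<longlonglongrightarrow> 0 + L * 0"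
    by (intro tendsto_intros w)
  then show ?thesis
    by (simp add: algebra_simps sum_subtractf sum_distrib_left diff_divide_distrib)
qed

text \<open>Abel summation writes the weighted mean as the partial sum \<open>B N\<close> minus the
  mean of the earlier partial sums; both tend to \<open>suminf b\<close>.\<close>

lemma kronecker_mean_tendsto_0:
  fixes b :: "nat \<Rightarrow> 'a::{real_normed_field}"
  assumes "summable b"
  shows "(\<lambda>N. (\<Sum>n=1..N. of_nat n * b n) / of_nat N) \<longlonglongrightarrow> 0"
proof -
  define B where "B = (\<lambda>N. \<Sum>n\<le>N. b n)"
  have B: "B \<longlonglongrightarrow> suminf b"
    unfolding B_def using assms by (rule summable_LIMSEQ')
  have "(\<lambda>n. B (n - 1)) \<longlonglongrightarrow> suminf b"
    by (rule LIMSEQ_imp_Suc) (simp add: B)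
  then have "(\<lambda>N. B N - (\<Sum>n=1..N. B (n - 1)) / of_nat N) \<longlonglongrightarrow> suminf b - suminf b"
    by (intro tendsto_diff B cesaro_mean_tendsto)
  moreover have abel: "(\<Sum>n=1..N. of_nat n * b n) = of_nat N * B N - (\<Sum>n=1..N. B (n - 1))" for N
    by (induction N) (auto simp: B_def algebra_simps)
  have "\<forall>\<^sub>F N in sequentially. B N - (\<Sum>n=1..N. B (n - 1)) / of_nat N = (\<Sum>n=1..N. of_nat n * b n) / of_nat N"
    using eventually_gt_at_top[of 0]
    by eventually_elim (unfold abel, simp add: diff_divide_distrib)
  ultimately show ?thesis by (simp add: Lim_transform_eventually)
qed

subsection \<open>Newman's Tauberian theorem\<close>

lemma norm_nat_powr: "n > 0 \<Longrightarrow> norm (of_nat n powr z :: complex) = real n powr Re z"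
  by (simp add: norm_powr_real_powr)

text \<open>The mean value theorem for \<open>t powr (-x)\<close>. Read as an upper bound, it
  dominates each term of a tail by a telescoping difference.\<close>

lemma powr_neg_diff_lower_bound:
  fixes x :: real
  assumes x: "x > 0" and n: "n \<ge> 1"
  shows "x * real (Suc n) powr (-1 - x) \<le> real n powr (-x) - real (Suc n) powr (-x)"
proof -
  have "\<exists>z. real n < z \<and> z < real (Suc n) \<and>
      - (real (Suc n) powr (-x)) - (- (real n powr (-x))) = (real (Suc n) - real n) * (x * z powr (-1 - x))"
    using n by (intro MVT2) (auto intro!: derivative_eq_intros simp: powr_diff powr_minus field_simps)
  then obtain z where z: "real n < z" "z < real (Suc n)"
    "real n powr (-x) - real (Suc n) powr (-x) = x * z powr (-1 - x)"
    by auto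
  have "real (Suc n) powr (-1 - x) \<le> z powr (-1 - x)"
    using z n x by (intro powr_mono2') auto
  then show ?thesis using z x by simp
qed

text \<open>Whether \<open>t powr (x - 1)\<close> increases or decreases depends on the sign of
  \<open>x - 1\<close>; the minimum over both endpoints covers the two cases at once.\<close>

lemma powr_diff_lower_bound:
  fixes x :: real
  assumes x: "x > 0" and n: "n \<ge> 1"
  shows "x * min (real n powr (x - 1)) (real (Suc n) powr (x - 1)) \<le> real (Suc n) powr x - real n powr x"
proof -
  have "\<exists>z. real n < z \<and> z < real (Suc n) \<and>
      (real (Suc n) powr x) - (real n powr x) = (real (Suc n) - real n) * (x * z powr (x - 1))"
    using n by (intro MVT2) (auto intro!: derivative_eq_intros simp: powr_diff field_simps)
  then obtain z where z: "real n < z" "z < real (Suc n)"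
    "real (Suc n) powr x - real n powr x = x * z powr (x - 1)"
    by auto
  have "min (real n powr (x - 1)) (real (Suc n) powr (x - 1)) \<le> z powr (x - 1)"
  proof (cases "x \<ge> 1")
    case True
    then have "real n powr (x - 1) \<le> z powr (x - 1)" using z n by (intro powr_mono2) auto
    then show ?thesis by linarith
  next
    case False
    then have "real (Suc n) powr (x - 1) \<le> z powr (x - 1)" using z n by (intro powr_mono2') auto
    then show ?thesis by linarith
  qed
  then show ?thesis using z x by simp
qed

text \<open>Telescoping with \<open>powr_diff_lower_bound\<close>. For \<open>x \<ge> 1\<close> the
  terms increase, so only those below \<open>N\<close> are compared with the integral and the last
  one is added separately; for \<open>x < 1\<close> they decrease and the integral term
  suffices.\<close>

lemma sum_powr_le:
  fixes x :: real
  assumes x: "x > 0" and N: "N \<ge> 1"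
  shows "(\<Sum>n=1..N. real n powr (x - 1)) \<le> real N powr x / x + real N powr (x - 1)"
proof (cases "x \<ge> 1")
  case True
  from N have "(\<Sum>n=1..<N. real n powr (x - 1)) \<le> real N powr x / x"
  proof (induction N rule: nat_induct_at_least)
    case base
    then show ?case using x by simp
  next
    case (Suc n)
    have "real n powr (x - 1) \<le> real (Suc n) powr (x - 1)"
      using True by (intro powr_mono2) auto
    then have "x * real n powr (x - 1) \<le> real (Suc n) powr x - real n powr x"
      using powr_diff_lower_bound[OF x Suc(1)] by (simp add: min_def)
    then show ?case using Suc x by (simp add: field_simps)
  qed
  moreover have "{1..N} = insert N {1..<N}" using N by auto
  ultimately show ?thesis by simp
next
  case False
  from N have "(\<Sum>n=1..N. real n powr (x - 1)) \<le> real N powr x / x"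
  proof (induction N rule: nat_induct_at_least)
    case base
    then show ?case using x False by simp
  next
    case (Suc n)
    have "real (Suc n) powr (x - 1) \<le> real n powr (x - 1)"
      using False Suc by (intro powr_mono2') auto
    then have "x * real (Suc n) powr (x - 1) \<le> real (Suc n) powr x - real n powr x"
      using powr_diff_lower_bound[OF x Suc(1)] by (simp add: min_def split: if_splits)
    then show ?case using Suc x by (simp add: field_simps)
  qed
  then show ?thesis using powr_ge_zero[of "real N" "x - 1"] by linarith
qed

section \<open>Newman's kernel and the contour integrals\<close>

text \<open>On the circle \<open>R^2 = z * cnj z\<close>, so the kernel collapses to the real number
  \<open>(z + cnj z) / R^2\<close>, which vanishes on the imaginary axis.\<close>

lemma newman_kernel_norm:
  assumes "norm z = R" "R > 0"
  shows "norm ((1 + z\<^sup>2 / of_real (R\<^sup>2)) / z) = 2 * \<bar>Re z\<bar> / R\<^sup>2"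
proof -
  have z: "z \<noteq> 0" using assms by auto
  have zz: "of_real (R\<^sup>2) = z * cnj z" using assms complex_norm_square[of z] by simp
  have "(1 + z\<^sup>2 / of_real (R\<^sup>2)) / z = (cnj z + z) / of_real (R\<^sup>2)"
    unfolding zz using z by (simp add: field_simps power2_eq_square)
  also have "cnj z + z = of_real (2 * Re z)" by (simp add: complex_eq_iff)
  also have "norm (of_real (2 * Re z) / of_real (R\<^sup>2) :: complex) = 2 * \<bar>Re z\<bar> / R\<^sup>2"
    by (simp add: norm_divide norm_power norm_mult)
  finally show ?thesis .
qed

text \<open>The circle path starts at the point \<open>R\<close>, in the middle of the right half
  circle, which therefore appears as two quarter arcs.\<close>

lemma contour_integral_circlepath_split3:
  assumes "continuous_on (sphere 0 R) f" "0 \<le> R"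
  shows "contour_integral (circlepath 0 R) f =
     contour_integral (part_circlepath 0 R 0 (pi/2)) f +
     contour_integral (part_circlepath 0 R (pi/2) (3*pi/2)) f +
     contour_integral (part_circlepath 0 R (3*pi/2) (2*pi)) f"
proof -
  let ?g = "\<lambda>t. f (0 + R * cis t) * R * \<i> * cis t"
  have int: "?g integrable_on {0..2*pi}"
    using assms by (intro integrable_continuous_real continuous_intros continuous_on_compose2[OF assms(1)])
       (auto simp: dist_norm norm_mult)
  have sub: "?g integrable_on {0..3*pi/2}"
    by (rule integrable_subinterval_real[OF int]) auto
  have "integral {0..2*pi} ?g = integral {0..3*pi/2} ?g + integral {3*pi/2..2*pi} ?g"
    by (rule Henstock_Kurzweil_Integration.integral_combine[symmetric]) (use int in auto)
  also have "integral {0..3*pi/2} ?g = integral {0..pi/2} ?g + integral {pi/2..3*pi/2} ?g"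
    by (rule Henstock_Kurzweil_Integration.integral_combine[symmetric]) (use sub in auto)
  finally show ?thesis
    unfolding circlepath_def by (simp add: contour_integral_part_circlepath_eq)
qed

text \<open>Integration by parts: differentiating \<open>H z * N powr z\<close> produces the
  integrand with a factor \<open>ln N\<close>. On the imaginary axis \<open>N powr z\<close> has
  modulus 1, so the boundary values and the integral of \<open>deriv H z * N powr z\<close> are
  bounded uniformly in \<open>N\<close>.\<close>

lemma contour_integral_vertical_powr_bound:
  assumes U: "open U" "H holomorphic_on U" and seg: "closed_segment (\<i> * of_real R) (- (\<i> * of_real R)) \<subseteq> U"
  obtains C where "\<And>N::nat. N \<ge> 2 \<Longrightarrow>
    norm (contour_integral (linepath (\<i> * of_real R) (- (\<i> * of_real R))) (\<lambda>z. H z * of_nat N powr z))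
      \<le> C / ln (real N)"
proof -
  define p where "p = \<i> * complex_of_real R"
  let ?L = "closed_segment p (-p)"
  have seg: "?L \<subseteq> U" using seg by (simp add: p_def)
  have contH: "continuous_on ?L H"
    using U seg by (meson holomorphic_on_imp_continuous_on holomorphic_on_subset)
  have holD: "deriv H holomorphic_on U" using U by (simp add: holomorphic_deriv)
  have contD: "continuous_on ?L (deriv H)"
    using holD seg by (meson holomorphic_on_imp_continuous_on holomorphic_on_subset)
  obtain B where B: "\<And>z. z \<in> ?L \<Longrightarrow> norm (H z) \<le> B"
    using compact_imp_bounded[OF compact_continuous_image[OF contH compact_segment]]
    unfolding bounded_iff by auto
  obtain D where D: "\<And>z. z \<in> ?L \<Longrightarrow> norm (deriv H z) \<le> D"
    using compact_imp_bounded[OF compact_continuous_image[OF contD compact_segment]]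
    unfolding bounded_iff by auto
  have D0: "D \<ge> 0" using D[of p] norm_ge_zero order_trans by (metis ends_in_segment(1))
  have Re0: "Re z = 0" if "z \<in> ?L" for z
    using that by (auto simp: closed_segment_def p_def)
  have "norm (contour_integral (linepath p (-p)) (\<lambda>z. H z * of_nat N powr z))
      \<le> (B + B + D * norm (- p - p)) / ln (real N)" if N: "N \<ge> 2" for N :: nat
  proof -
    let ?W = "\<lambda>z. of_nat N powr z :: complex"
    let ?l = "complex_of_real (ln (real N))"
    have lpos: "ln (real N) > 0" using N by simp
    have W1: "norm (?W z) = 1" if "z \<in> ?L" for z
      using Re0[OF that] N by (simp add: norm_nat_powr)
    have der: "((\<lambda>z. H z * ?W z) has_field_derivative (deriv H z * ?W z + ?l * (H z * ?W z))) (at z within U)"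
      if "z \<in> U" for z
    proof -
      have "(H has_field_derivative deriv H z) (at z)"
        using U that by (simp add: holomorphic_derivI)
      moreover have "(?W has_field_derivative Ln (of_nat N) * ?W z) (at z)"
        using N by (intro has_field_derivative_powr_right) auto
      moreover have "Ln (of_nat N) = ?l"
        using N by (simp add: Ln_of_nat)
      ultimately have "((\<lambda>z. H z * ?W z) has_field_derivative (deriv H z * ?W z + ?l * (H z * ?W z))) (at z)"
        using DERIV_mult by (fastforce simp: mult_ac add.commute)
      then show ?thesis by (rule has_field_derivative_at_within)
    qed
    have prim: "((\<lambda>z. deriv H z * ?W z + ?l * (H z * ?W z)) has_contour_integral
        (H (-p) * ?W (-p) - H p * ?W p)) (linepath p (-p))"
      using contour_integral_primitive[OF der, of "linepath p (-p)"] seg by simp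
    have int: "(\<lambda>z. deriv H z * ?W z) contour_integrable_on linepath p (-p)"
      "(\<lambda>z. H z * ?W z) contour_integrable_on linepath p (-p)"
      by (intro contour_integrable_continuous_linepath continuous_intros contH contD; use N in simp)+
    have "H (-p) * ?W (-p) - H p * ?W p =
       contour_integral (linepath p (-p)) (\<lambda>z. deriv H z * ?W z + ?l * (H z * ?W z))"
      using prim by (simp add: contour_integral_unique)
    also have "\<dots> = contour_integral (linepath p (-p)) (\<lambda>z. deriv H z * ?W z)
        + ?l * contour_integral (linepath p (-p)) (\<lambda>z. H z * ?W z)"
      using int by (simp add: contour_integral_add contour_integral_lmul contour_integrable_lmul)
    finally have eq: "?l * contour_integral (linepath p (-p)) (\<lambda>z. H z * ?W z) =
       H (-p) * ?W (-p) - H p * ?W p - contour_integral (linepath p (-p)) (\<lambda>z. deriv H z * ?W z)"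
      by (simp add: algebra_simps)
    have b1: "norm (H (-p) * ?W (-p)) \<le> B" "norm (H p * ?W p) \<le> B"
      using B W1 by (simp_all add: norm_mult)
    have b2: "norm (contour_integral (linepath p (-p)) (\<lambda>z. deriv H z * ?W z)) \<le> D * norm (- p - p)"
      using int(1) D0 D W1 by (intro contour_integral_bound_linepath) (auto simp: norm_mult)
    have "norm (?l * contour_integral (linepath p (-p)) (\<lambda>z. H z * ?W z)) \<le> B + B + D * norm (- p - p)"
      unfolding eq using b1 b2 by (meson norm_triangle_le_diff add_mono norm_triangle_ineq4 order_trans)
    then show ?thesis using lpos by (simp add: norm_mult field_simps)
  qed
  then show ?thesis using that unfolding p_def by blast
qed

lemma Re_nonneg_part_circlepath:
  assumes "z \<in> path_image (part_circlepath 0 R 0 (pi/2)) \<union> path_image (part_circlepath 0 R (3*pi/2) (2*pi))"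
    "R > 0"
  shows "Re z \<ge> 0"
proof -
  have "cos t \<ge> 0" if "3*pi/2 \<le> t" "t \<le> 2*pi" for t
    using cos_ge_zero[of "t - 2 * pi"] that cos_periodic[of "t - 2*pi"] by simp
  with assms show ?thesis
    by (auto simp: path_image_part_circlepath' closed_segment_eq_real_ivl intro!: mult_nonneg_nonneg cos_ge_zero)
qed

lemma Re_nonpos_part_circlepath:
  assumes "z \<in> path_image (part_circlepath 0 R (pi/2) (3*pi/2))" "R > 0"
  shows "Re z \<le> 0"
proof -
  have "cos t \<le> 0" if "pi/2 \<le> t" "t \<le> 3*pi/2" for t
    using cos_ge_zero[of "t - pi"] that by (simp add: cos_diff)
  with assms show ?thesis
    by (auto simp: path_image_part_circlepath' closed_segment_eq_real_ivl mult_nonneg_nonpos)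
qed


section \<open>Tails and partial sums of Dirichlet series\<close>

text \<open>By \<open>powr_neg_diff_lower_bound\<close> each term is dominated by a telescoping
  difference, so the bound holds for the block between \<open>N\<close> and \<open>M\<close> and
  survives the limit in \<open>M\<close>.\<close>

lemma dirichlet_tail_bound:
  fixes a :: "nat \<Rightarrow> complex"
  assumes a: "\<And>n. norm (a n) \<le> 1" and z: "Re z > 0" and N: "N \<ge> 1"
    and F: "(\<lambda>n. a n * of_nat n powr (-1 - z)) sums F"
  shows "norm (F - (\<Sum>n\<le>N. a n * of_nat n powr (-1 - z))) \<le> real N powr (- Re z) / Re z"
proof -
  let ?f = "\<lambda>n. a n * of_nat n powr (-1 - z)"
  let ?S = "\<lambda>M. \<Sum>n\<le>M. ?f n"
  have "norm (?S M - ?S N) \<le> (real N powr (- Re z) - real M powr (- Re z)) / Re z" if "M \<ge> N" for M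
    using that
  proof (induction M rule: nat_induct_at_least)
    case base
    then show ?case by simp
  next
    case (Suc n)
    have "norm (?f (Suc n)) \<le> 1 * real (Suc n) powr (-1 - Re z)"
      unfolding norm_mult using a[of "Suc n"] norm_nat_powr[of "Suc n" "-1 - z"] by (intro mult_mono) auto
    also have "\<dots> \<le> (real n powr (- Re z) - real (Suc n) powr (- Re z)) / Re z"
      using powr_neg_diff_lower_bound[OF z, of n] Suc N z by (simp add: field_simps)
    finally have step: "norm (?f (Suc n)) \<le> (real n powr (- Re z) - real (Suc n) powr (- Re z)) / Re z" .
    have "norm (?S (Suc n) - ?S N) = norm ((?S n - ?S N) + ?f (Suc n))"
      by (simp add: diff_add_eq)
    also have "\<dots> \<le> norm (?S n - ?S N) + norm (?f (Suc n))" by (rule norm_triangle_ineq)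
    also have "\<dots> \<le> (real N powr (- Re z) - real (Suc n) powr (- Re z)) / Re z"
      using Suc step by (simp add: diff_divide_distrib)
    finally show ?case .
  qed
  also have "(real N powr (- Re z) - real M powr (- Re z)) / Re z \<le> real N powr (- Re z) / Re z" for M
    using z by (intro divide_right_mono) auto
  finally have "\<forall>\<^sub>F M in sequentially. norm (?S M - ?S N) \<le> real N powr (- Re z) / Re z"
    by (metis (mono_tags, lifting) eventually_sequentiallyI)
  moreover have "(\<lambda>M. norm (?S M - ?S N)) \<longlonglongrightarrow> norm (F - ?S N)"
    using F unfolding sums_def_le by (intro tendsto_intros)
  ultimately show ?thesis using tendsto_upperbound sequentially_bot by blast
qed

text \<open>Left of the imaginary axis only the partial sum is available; taking norms reduces its
  size to \<open>sum_powr_le\<close> with exponent \<open>- Re z\<close>.\<close>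

lemma dirichlet_head_bound:
  fixes a :: "nat \<Rightarrow> complex"
  assumes a: "\<And>n. norm (a n) \<le> 1" and z: "Re z < 0" and N: "N \<ge> 1"
  shows "norm (\<Sum>n\<le>N. a n * of_nat n powr (-1 - z))
     \<le> real N powr (- Re z) * (1 / (- Re z) + 1 / real N)"
proof -
  \<comment> \<open>The summand at \<open>n = 0\<close> vanishes because
    \<open>0 powr z = 0\<close>.\<close>
  have "norm (\<Sum>n\<le>N. a n * of_nat n powr (-1 - z)) = norm (\<Sum>n=1..N. a n * of_nat n powr (-1 - z))"
    by (rule arg_cong[where f = norm], rule sum.mono_neutral_right) auto
  also have "\<dots> \<le> (\<Sum>n=1..N. real n powr (- Re z - 1))"
  proof (rule order_trans[OF norm_sum], rule sum_mono)
    fix n assume "n \<in> {1..N}"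
    moreover have "Re (-1 - z) = - Re z - 1" by simp
    ultimately have "norm (of_nat n powr (-1 - z) :: complex) = real n powr (- Re z - 1)"
      by (metis norm_nat_powr atLeastAtMost_iff less_le_trans zero_less_one)
    then show "norm (a n * of_nat n powr (-1 - z)) \<le> real n powr (- Re z - 1)"
      using a[of n] by (simp add: norm_mult mult_left_le_one_le)
  qed
  also have "\<dots> \<le> real N powr (- Re z) / (- Re z) + real N powr (- Re z - 1)"
    using z N by (intro sum_powr_le) auto
  also have "\<dots> = real N powr (- Re z) * (1 / (- Re z) + 1 / real N)"
    using N by (simp add: powr_diff algebra_simps)
  finally show ?thesis .
qed

text \<open>This is \<open>u \<le> exp u\<close> at \<open>u = x * ln N\<close>. On the left arc it
  makes the contribution of the constant \<open>F 0\<close> of order \<open>1 / ln N\<close>,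
  uniformly up to the imaginary axis.\<close>

lemma mult_nat_powr_neg_le:
  fixes x :: real
  assumes "N \<ge> 2" "x \<ge> 0"
  shows "x * real N powr (- x) \<le> 1 / ln (real N)"
proof -
  have l: "ln (real N) > 0" using assms by simp
  have "x * ln (real N) \<le> exp (x * ln (real N))"
    using exp_ge_add_one_self[of "x * ln (real N)"] by linarith
  also have "\<dots> = real N powr x" using assms by (simp add: powr_def)
  finally show ?thesis using l assms by (simp add: powr_minus field_simps)
qed

text \<open>The estimate compares two contour integrals of the kernel \<open>N powr z * (1/z + z/R\<^sup>2)\<close>: that of the
  partial sum over the full circle of radius \<open>R\<close>, and that of \<open>F - F 0\<close> over the boundary of the right
  half disc. Subtracting \<open>F 0\<close> removes the pole, so the second contour may run along the imaginary axis
  itself, where integration by parts gives the decay \<open>O(1 / ln N)\<close>. On the circle the kernel has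
  modulus \<open>2 * \<bar>Re z\<bar> / R\<^sup>2 * N powr Re z\<close>, which cancels the blow-up of the tail and of the partial
  sum at \<open>Re z = 0\<close>.\<close>

lemma newman_estimate:
  fixes a :: "nat \<Rightarrow> complex" and F :: "complex \<Rightarrow> complex"
  assumes a: "\<And>n. norm (a n) \<le> 1"
    and U: "open U" "{z. Re z \<ge> 0} \<subseteq> U" and F: "F holomorphic_on U"
    and sums: "\<And>z. Re z > 0 \<Longrightarrow> (\<lambda>n. a n * of_nat n powr (-1 - z)) sums F z"
    and R: "R > 0"
  obtains C where "\<And>N::nat. N \<ge> 2 \<Longrightarrow>
     norm ((\<Sum>n\<le>N. a n / of_nat n) - F 0) \<le> 2 / R + 1 / real N + C / ln (real N)"
proof -
  define c where "c = F 0"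
  \<comment> \<open>\<open>Q\<close> is the difference quotient of \<open>F\<close> at 0 with its
    removable singularity filled in, hence holomorphic on all of \<open>U\<close>.\<close>
  define Q where "Q = (\<lambda>z. if z = 0 then deriv F 0 else (F z - F 0) / (z - 0))"
  define k where "k = (\<lambda>z::complex. 1 + z\<^sup>2 / of_real (R\<^sup>2))"
  define H where "H = (\<lambda>z. Q z * k z)"
  have "Q holomorphic_on U" unfolding Q_def by (rule pole_lemma_open[OF F U(1)])
  then have H: "H holomorphic_on U"
    unfolding H_def k_def by (intro holomorphic_intros) (use R in auto)
  define p where "p = \<i> * complex_of_real R"
  have halfplane: "convex {z. Re z \<ge> 0}"
    using convex_halfspace_Re_ge by blast
  have seg: "closed_segment p (-p) \<subseteq> {z. Re z \<ge> 0}"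
    by (intro closed_segment_subset halfplane) (auto simp: p_def)
  obtain C where C: "\<And>N::nat. N \<ge> 2 \<Longrightarrow>
     norm (contour_integral (linepath p (-p)) (\<lambda>z. H z * of_nat N powr z)) \<le> C / ln (real N)"
    using contour_integral_vertical_powr_bound[OF U(1) H, of R] seg U(2) unfolding p_def by blast
  let ?p1 = "part_circlepath 0 R 0 (pi/2)"
  let ?p2 = "part_circlepath 0 R (pi/2) (3*pi/2)"
  let ?p3 = "part_circlepath 0 R (3*pi/2) (2*pi)"
  have sph: "path_image ?p1 \<subseteq> sphere 0 R" "path_image ?p2 \<subseteq> sphere 0 R" "path_image ?p3 \<subseteq> sphere 0 R"
    using R by (intro path_image_part_circlepath_subset; simp)+
  have right: "path_image ?p1 \<subseteq> {z. Re z \<ge> 0}" "path_image ?p3 \<subseteq> {z. Re z \<ge> 0}"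
    using Re_nonneg_part_circlepath R by auto
  have "norm ((\<Sum>n\<le>N. a n / of_nat n) - F 0) \<le> 2 / R + 1 / real N + (norm c / R + C / (2 * pi)) / ln (real N)"
    if N: "N \<ge> 2" for N :: nat
  proof -
    define W where "W = (\<lambda>z. of_nat N powr z :: complex)"
    define S where "S = (\<lambda>z. \<Sum>n\<le>N. a n * of_nat n powr (-1 - z))"
    \<comment> \<open>Away from 0 the integrand \<open>H z * W z\<close> splits as
      \<open>G z + r z\<close>. The numerator of \<open>G\<close> contains only the partial sum and
      is entire, so \<open>G\<close> makes sense on the whole circle; \<open>r\<close> carries the
      tail, which is controlled to the right of the imaginary axis.\<close>
    define G where "G = (\<lambda>z. (S z - c) * W z * k z / z)"
    define r where "r = (\<lambda>z. (F z - S z) * W z * k z / z)"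
    have l: "ln (real N) > 0" using N by simp
    have hS: "(\<lambda>z. (S z - c) * W z * k z) holomorphic_on A" for A
      unfolding S_def W_def k_def by (intro holomorphic_intros) (use R in auto)
    have contG: "continuous_on A G" if "0 \<notin> A" for A
      unfolding G_def using that
      by (intro continuous_on_divide holomorphic_on_imp_continuous_on[OF hS] continuous_intros) auto
    have HG: "H z * W z = G z + r z" if "z \<noteq> 0" for z
      using that by (simp add: H_def Q_def G_def r_def c_def field_simps)
    have hH: "(\<lambda>z. H z * W z) holomorphic_on U"
      unfolding W_def by (intro holomorphic_intros H)
    have contH: "continuous_on A (\<lambda>z. H z * W z)" if "A \<subseteq> {z. Re z \<ge> 0}" for A
      using hH U(2) that by (meson holomorphic_on_imp_continuous_on holomorphic_on_subset order_trans)
    have contr: "continuous_on A r" if "A \<subseteq> {z. Re z \<ge> 0}" "0 \<notin> A" for A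
    proof -
      have "continuous_on A (\<lambda>z. H z * W z - G z)"
        by (intro continuous_on_diff contH contG that)
      then show ?thesis using HG that(2) by (elim continuous_on_eq) (metis add_diff_cancel_left')
    qed
    have no0: "0 \<notin> path_image ?p1" "0 \<notin> path_image ?p2" "0 \<notin> path_image ?p3"
      using sph R by auto
    have iG: "G contour_integrable_on ?p1" "G contour_integrable_on ?p2" "G contour_integrable_on ?p3"
      using no0 by (intro contour_integrable_continuous_part_circlepath contG; simp)+
    have ir: "r contour_integrable_on ?p1" "r contour_integrable_on ?p3"
      using no0 right by (intro contour_integrable_continuous_part_circlepath contr; simp)+
    \<comment> \<open>Cauchy's integral formula at the centre, where \<open>W\<close> and
      \<open>k\<close> equal 1, reads off the error \<open>S 0 - c\<close>.\<close>
    have circ: "contour_integral (circlepath 0 R) G = 2 * of_real pi * \<i> * (S 0 - c)"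
    proof -
      have "((\<lambda>u. (S u - c) * W u * k u / (u - 0)) has_contour_integral
          (2 * of_real pi * \<i> * ((S 0 - c) * W 0 * k 0))) (circlepath 0 R)"
        by (rule Cauchy_integral_circlepath_simple[OF hS]) (use R in auto)
      moreover have "W 0 = 1" "k 0 = 1" using N by (auto simp: W_def k_def)
      ultimately show ?thesis unfolding G_def by (simp add: contour_integral_unique)
    qed
    have ends: "pathfinish ?p1 = p" "pathstart ?p3 = - p" "pathstart ?p1 = of_real R" "pathfinish ?p3 = of_real R"
    proof -
      have "cis (3*pi/2) = -\<i>"
        using cos_3over2_pi sin_3over2_pi by (simp add: complex_eq_iff)
      then show "pathfinish ?p1 = p" "pathstart ?p3 = - p" "pathstart ?p1 = of_real R" "pathfinish ?p3 = of_real R"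
        unfolding pathfinish_part_circlepath pathstart_part_circlepath cis_conv_exp[symmetric]
        by (simp_all add: p_def)
    qed
    \<comment> \<open>The closed contour runs from \<open>R\<close> along the arc to
      \<open>p\<close>, straight down the diameter to \<open>-p\<close>, and along the arc back to
      \<open>R\<close>. The diameter passes through 0, where \<open>H\<close> is regular.\<close>
    have "((\<lambda>z. H z * W z) has_contour_integral 0) (?p1 +++ (linepath p (-p) +++ ?p3))"
    proof (rule Cauchy_theorem_convex_simple)
      show "(\<lambda>z. H z * W z) holomorphic_on {z. Re z \<ge> 0}"
        using hH U(2) holomorphic_on_subset by blast
      show "path_image (?p1 +++ (linepath p (-p) +++ ?p3)) \<subseteq> {z. Re z \<ge> 0}"
        using right seg ends by (simp add: path_image_join)
    qed (use ends halfplane in \<open>auto intro!: valid_path_join\<close>)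
    moreover have iH: "(\<lambda>z. H z * W z) contour_integrable_on ?p1"
        "(\<lambda>z. H z * W z) contour_integrable_on ?p3"
        "(\<lambda>z. H z * W z) contour_integrable_on linepath p (-p)"
      using right seg
      by (intro contour_integrable_continuous_part_circlepath contour_integrable_continuous_linepath contH; simp)+
    ultimately have "0 = contour_integral ?p1 (\<lambda>z. H z * W z)
        + (contour_integral (linepath p (-p)) (\<lambda>z. H z * W z) + contour_integral ?p3 (\<lambda>z. H z * W z))"
      using ends by (auto dest!: contour_integral_unique simp: contour_integrable_joinI)
    moreover have "contour_integral q (\<lambda>z. H z * W z) = contour_integral q G + contour_integral q r"
      if "q = ?p1 \<or> q = ?p3" for q
    proof -
      have "contour_integral q (\<lambda>z. H z * W z) = contour_integral q (\<lambda>z. G z + r z)"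
        using that no0 by (intro contour_integral_eq) (metis HG)
      also have "\<dots> = contour_integral q G + contour_integral q r"
        using that iG ir by (intro contour_integral_add) auto
      finally show ?thesis .
    qed
    moreover have "2 * of_real pi * \<i> * (S 0 - c) =
        contour_integral ?p1 G + contour_integral ?p2 G + contour_integral ?p3 G"
      unfolding circ[symmetric] using R by (intro contour_integral_circlepath_split3 contG) auto
    \<comment> \<open>Cauchy's theorem trades \<open>G\<close> on the two right arcs for
      \<open>- r\<close> on them and minus the diameter integral; on the left arc \<open>G\<close>
      itself stays.\<close>
    ultimately have main: "2 * of_real pi * \<i> * (S 0 - c) = contour_integral ?p2 G
        - contour_integral ?p1 r - contour_integral ?p3 r - contour_integral (linepath p (-p)) (\<lambda>z. H z * W z)"
      by (simp add: algebra_simps)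
    have kz: "norm (k z / z) = 2 * \<bar>Re z\<bar> / R\<^sup>2" if "norm z = R" for z
      unfolding k_def by (rule newman_kernel_norm) (use that R in auto)
    have Wz: "norm (W z) = real N powr Re z" for z
      unfolding W_def using N by (simp add: norm_nat_powr)
    have rb: "norm (r z) \<le> 2 / R\<^sup>2" if z: "norm z = R" "Re z \<ge> 0" for z
    proof (cases "Re z = 0")
      case True
      then have "norm (r z) = 0"
        using kz[OF z(1)] by (simp add: r_def norm_mult norm_divide)
      then show ?thesis by simp
    next
      case False
      then have x: "Re z > 0" using z by simp
      have "norm (r z) = norm (F z - S z) * norm (W z) * norm (k z / z)"
        by (simp add: r_def norm_mult norm_divide)
      also have "\<dots> \<le> (real N powr (- Re z) / Re z) * norm (W z) * norm (k z / z)"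
        unfolding S_def using N
        by (intro mult_right_mono dirichlet_tail_bound a x sums) auto
      also have "\<dots> = 2 / R\<^sup>2"
        using x N by (simp add: kz[OF z(1)] Wz powr_minus field_simps)
      finally show ?thesis .
    qed
    \<comment> \<open>The three summands stem from \<open>1 / x\<close> and \<open>1 / N\<close> in
      the bound of the partial sum and from the constant \<open>c\<close>; in the second,
      \<open>x \<le> R\<close> is used.\<close>
    have Gb: "norm (G z) \<le> 2 / R\<^sup>2 + 2 / (R * real N) + 2 * norm c / (R\<^sup>2 * ln (real N))"
      if z: "norm z = R" "Re z \<le> 0" for z
    proof (cases "Re z = 0")
      case True
      then have "norm (G z) = 0"
        using kz[OF z(1)] by (simp add: G_def norm_mult norm_divide)
      then show ?thesis using l R by simp
    next
      case False
      define x where "x = - Re z"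
      have x: "x > 0" using False z by (simp add: x_def)
      have xR: "x \<le> R" using z abs_Re_le_cmod[of z] by (simp add: x_def)
      have "norm (G z) = norm (S z - c) * norm (W z) * norm (k z / z)"
        by (simp add: G_def norm_mult norm_divide)
      also have "\<dots> \<le> (real N powr x * (1 / x + 1 / real N) + norm c) * norm (W z) * norm (k z / z)"
      proof (intro mult_right_mono)
        have "norm (S z) \<le> real N powr x * (1 / x + 1 / real N)"
          unfolding S_def x_def using N z False by (intro dirichlet_head_bound a) auto
        then show "norm (S z - c) \<le> real N powr x * (1 / x + 1 / real N) + norm c"
          using norm_triangle_ineq4[of "S z" c] by linarith
      qed auto
      also have "\<dots> = 2 / R\<^sup>2 + 2 / R\<^sup>2 * (x / real N) + 2 * norm c / R\<^sup>2 * (x * real N powr (- x))"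
      proof -
        have "norm (k z / z) = 2 * x / R\<^sup>2" using kz[OF z(1)] z by (simp add: x_def)
        moreover have "norm (W z) = real N powr (- x)" by (simp add: Wz x_def)
        ultimately show ?thesis using x N R by (simp add: powr_minus field_simps)
      qed
      also have "\<dots> \<le> 2 / R\<^sup>2 + 2 / R\<^sup>2 * (R / real N) + 2 * norm c / R\<^sup>2 * (1 / ln (real N))"
        using xR x N by (intro add_mono mult_left_mono divide_right_mono mult_nat_powr_neg_le) auto
      also have "\<dots> = 2 / R\<^sup>2 + 2 / (R * real N) + 2 * norm c / (R\<^sup>2 * ln (real N))"
        using R by (simp add: power2_eq_square)
      finally show ?thesis .
    qed
    have b1: "norm (contour_integral ?p1 r) \<le> 2 / R\<^sup>2 * R * \<bar>pi/2 - 0\<bar>"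
      using ir(1) R right(1) sph(1) by (intro contour_integral_bound_part_circlepath rb) auto
    have b3: "norm (contour_integral ?p3 r) \<le> 2 / R\<^sup>2 * R * \<bar>2*pi - 3*pi/2\<bar>"
      using ir(2) R right(2) sph(3) by (intro contour_integral_bound_part_circlepath rb) auto
    have b2: "norm (contour_integral ?p2 G) \<le>
        (2 / R\<^sup>2 + 2 / (R * real N) + 2 * norm c / (R\<^sup>2 * ln (real N))) * R * \<bar>3*pi/2 - pi/2\<bar>"
      using iG(2) R l sph(2) Re_nonpos_part_circlepath[OF _ R]
      by (intro contour_integral_bound_part_circlepath Gb) auto
    have b4: "norm (contour_integral (linepath p (-p)) (\<lambda>z. H z * W z)) \<le> C / ln (real N)"
      unfolding W_def by (rule C[OF N])
    have tri: "norm (w - u - v - t) \<le> norm w + norm u + norm v + norm t" for w u v t :: complex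
      by (smt (verit) norm_triangle_ineq4)
    have "2 * pi * norm (S 0 - c) = norm (2 * of_real pi * \<i> * (S 0 - c))"
      by (simp add: norm_mult)
    also have "\<dots> \<le> (2 / R\<^sup>2 + 2 / (R * real N) + 2 * norm c / (R\<^sup>2 * ln (real N))) * R * \<bar>3*pi/2 - pi/2\<bar>
       + 2 / R\<^sup>2 * R * \<bar>pi/2 - 0\<bar> + 2 / R\<^sup>2 * R * \<bar>2*pi - 3*pi/2\<bar> + C / ln (real N)"
      unfolding main by (rule order_trans[OF tri]) (intro add_mono b1 b2 b3 b4)
    \<comment> \<open>Left and right half circles have length \<open>pi * R\<close> each, so the two
      leading terms \<open>2 / R^2\<close> contribute \<open>4 * pi / R\<close>.\<close>
    also have "\<dots> = 2 * pi * (2 / R + 1 / real N + (norm c / R + C / (2 * pi)) / ln (real N))"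
      using R l N by (simp add: field_simps power2_eq_square)
    finally have "norm (S 0 - c) \<le> 2 / R + 1 / real N + (norm c / R + C / (2 * pi)) / ln (real N)"
      using pi_gt_zero by (simp only: mult_le_cancel_left_pos mult_pos_pos zero_less_numeral)
    \<comment> \<open>At \<open>n = 0\<close> both summands are 0, by \<open>0 powr z = 0\<close> on
      one side and division by 0 on the other.\<close>
    moreover have "S 0 = (\<Sum>n\<le>N. a n / of_nat n)"
      unfolding S_def by (intro sum.cong) (auto simp: powr_minus divide_inverse)
    ultimately show ?thesis by (simp add: c_def)
  qed
  then show ?thesis by (rule that)
qed

text \<open>The constant \<open>C\<close> of \<open>newman_estimate\<close> depends on the radius,
  so \<open>R\<close> is fixed first such that \<open>2 / R\<close> equals \<open>e / 2\<close>; the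
  remaining terms then vanish as \<open>N\<close> grows.\<close>

theorem newman_tauberian:
  fixes a :: "nat \<Rightarrow> complex" and F :: "complex \<Rightarrow> complex"
  assumes "\<And>n. norm (a n) \<le> 1"
    and "open U" "{z. Re z \<ge> 0} \<subseteq> U" and "F holomorphic_on U"
    and "\<And>z. Re z > 0 \<Longrightarrow> (\<lambda>n. a n * of_nat n powr (-1 - z)) sums F z"
  shows "(\<lambda>n. a n / of_nat n) sums F 0"
  unfolding sums_def_le
proof (rule LIMSEQ_I)
  fix e :: real assume e: "e > 0"
  define R where "R = 4 / e"
  have R: "R > 0" using e by (simp add: R_def)
  obtain C where C: "\<And>N::nat. N \<ge> 2 \<Longrightarrow>
     norm ((\<Sum>n\<le>N. a n / of_nat n) - F 0) \<le> 2 / R + 1 / real N + C / ln (real N)"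
    using newman_estimate[OF assms R] by blast
  have "(\<lambda>N. 1 / real N + C / ln (real N)) \<longlonglongrightarrow> 0"
    by real_asymp
  then obtain M where M: "\<And>N. N \<ge> M \<Longrightarrow> norm (1 / real N + C / ln (real N) - 0) < e / 2"
    using LIMSEQ_D[of _ 0 "e/2"] e by (meson half_gt_zero)
  have "norm ((\<Sum>n\<le>N. a n / of_nat n) - F 0) < e" if "N \<ge> max 2 M" for N
  proof -
    have "2 / R = e / 2" using e by (simp add: R_def)
    moreover have "1 / real N + C / ln (real N) < e / 2"
      using M[of N] that by (metis abs_less_iff diff_0_right max.bounded_iff real_norm_def)
    ultimately show ?thesis using C[of N] that by linarith
  qed
  then show "\<exists>no. \<forall>n\<ge>no. norm ((\<Sum>n\<le>n. a n / of_nat n) - F 0) < e" by blast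
qed

subsection \<open>The zeta function near the line Re s = 1\<close>

lemma norm_moebius_le_1: "norm (moebius n) \<le> 1"
  by (simp add: moebius_def)

lemma summable_nat_powr:
  assumes "Re s > 1"
  shows "summable (\<lambda>n. norm (of_nat n powr (-s) :: complex))" "summable (\<lambda>n. of_nat n powr (-s) :: complex)"
proof -
  have "norm (of_nat n powr (-s) :: complex) = real n powr (- Re s)" for n
    by (cases "n = 0") (simp_all add: norm_nat_powr)
  then show "summable (\<lambda>n. norm (of_nat n powr (-s) :: complex))"
    using assms by (simp add: summable_real_powr_iff)
  then show "summable (\<lambda>n. of_nat n powr (-s) :: complex)"
    by (rule summable_norm_cancel)
qed

section \<open>Continuation of \<open>(s - 1) * dirichlet_zeta s\<close> to
  \<open>Re s > 0\<close>\<close>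

text \<open>For \<open>Re s > 1\<close>, the only region where it is used, this is the Riemann zeta
  function; the summand at \<open>n = 0\<close> is 0 because \<open>0 powr z = 0\<close>.\<close>

definition dirichlet_zeta :: "complex \<Rightarrow> complex" where
  "dirichlet_zeta s = (\<Sum>n. of_nat n powr (-s))"

text \<open>With \<open>k = n + 1\<close> this is \<open>(s - 1)\<close> times the difference
  between \<open>k powr (-s)\<close> and the integral of \<open>x powr (-s)\<close> over
  \<open>{k..k+1}\<close>. Multiplied out, it has no denominator and needs no special case at
  \<open>s = 1\<close>.\<close>

definition zeta_term :: "nat \<Rightarrow> complex \<Rightarrow> complex" where
  "zeta_term n s = (s - 1) * of_nat (Suc n) powr (-s) - of_nat (Suc n) powr (1 - s) + of_nat (Suc (Suc n)) powr (1 - s)"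

text \<open>The extension of \<open>(s - 1) * dirichlet_zeta s\<close> to \<open>Re s > 0\<close>, obtained by comparing
  the series with the integral of \<open>x powr (-s)\<close> on each interval \<open>{n..n+1}\<close>.\<close>

definition reg_zeta :: "complex \<Rightarrow> complex" where
  "reg_zeta s = 1 + (\<Sum>n. zeta_term n s)"

text \<open>\<open>zeta_term n s\<close> is the first-order Taylor remainder of
  \<open>x powr (1 - s)\<close> from \<open>n + 1\<close> to \<open>n + 2\<close>, so the second
  derivative bounds it. The resulting decay is summable for every \<open>Re s > 0\<close>.\<close>

lemma norm_zeta_term_le:
  assumes s: "Re s > 0"
  shows "norm (zeta_term n s) \<le> norm s * norm (s - 1) * real (Suc n) powr (-1 - Re s)"
proof -
  define f :: "nat \<Rightarrow> complex \<Rightarrow> complex" where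
    "f = (\<lambda>i x. if i = 0 then x powr (1 - s) else if i = 1 then (1 - s) * x powr (-s)
             else (1 - s) * (-s) * x powr (-s - 1))"
  let ?w = "of_nat (Suc n) :: complex" and ?z = "of_nat (Suc (Suc n)) :: complex"
  have segm: "x \<in> \<real> \<and> Re x \<ge> real (Suc n)" if "x \<in> closed_segment ?w ?z" for x
  proof -
    have "closed_segment ?w ?z = of_real ` closed_segment (real (Suc n)) (real (Suc (Suc n)))"
      using closed_segment_of_real[of "real (Suc n)" "real (Suc (Suc n))"] by simp
    then show ?thesis using that by (auto simp: closed_segment_eq_real_ivl)
  qed
  have "cmod (f 0 ?z - (\<Sum>i\<le>1. f i ?w * (?z - ?w) ^ i / (fact i)))
      \<le> (norm s * norm (s - 1) * real (Suc n) powr (-1 - Re s)) * cmod (?z - ?w) ^ (Suc 1) / fact 1"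
  proof (rule complex_Taylor[where S = "closed_segment ?w ?z"])
    fix i x assume x: "x \<in> closed_segment ?w ?z" and i: "i \<le> (1::nat)"
    have "Re x > 0" using segm[OF x] by simp
    then have "x \<notin> \<real>\<^sub>\<le>\<^sub>0" by (simp add: complex_nonpos_Reals_iff)
    then have d: "((\<lambda>x. x powr a) has_field_derivative a * x powr (a - 1)) (at x within closed_segment ?w ?z)" for a
      by (rule has_field_derivative_at_within[OF has_field_derivative_powr])
    from i consider "i = 0" | "i = 1" by linarith
    then show "(f i has_field_derivative f (Suc i) x) (at x within closed_segment ?w ?z)"
    proof cases
      case 1
      then show ?thesis using d[of "1 - s"] by (simp add: f_def)
    next
      case 2
      then show ?thesis using DERIV_cmult[OF d[of "-s"], of "1 - s"] by (simp add: f_def mult.assoc)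
    qed
  next
    fix x assume x: "x \<in> closed_segment ?w ?z"
    have "norm (x powr (-s - 1)) = Re x powr (-1 - Re s)"
      using segm[OF x] by (subst norm_powr_real_powr) (auto simp: minus_diff_commute)
    also have "\<dots> \<le> real (Suc n) powr (-1 - Re s)"
      using segm[OF x] s by (intro powr_mono2') auto
    finally show "cmod (f (Suc 1) x) \<le> norm s * norm (s - 1) * real (Suc n) powr (-1 - Re s)"
      by (simp add: f_def norm_mult norm_minus_commute mult.commute mult_left_mono)
  qed auto
  moreover have "f 0 ?z - (\<Sum>i\<le>1. f i ?w * (?z - ?w) ^ i / (fact i)) = zeta_term n s"
    by (simp add: f_def zeta_term_def algebra_simps)
  ultimately show ?thesis by simp
qed

text \<open>Locally uniform convergence by the Weierstrass test: on the ball of radius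
  \<open>d = Re x / 2\<close> real parts stay at least \<open>d\<close>, which gives a summable
  majorant.\<close>

lemma holomorphic_reg_zeta: "reg_zeta holomorphic_on {s. Re s > 0}"
proof (rule holomorphic_uniform_sequence)
  show "open {s. Re s > 0}" by (rule open_halfspace_Re_gt)
  show "(\<lambda>s. 1 + (\<Sum>i<n. zeta_term i s)) holomorphic_on {s. Re s > 0}" for n
    unfolding zeta_term_def by (intro holomorphic_intros)
  fix x :: complex assume x: "x \<in> {s. Re s > 0}"
  define d where "d = Re x / 2"
  have d: "d > 0" using x by (simp add: d_def)
  have Re: "Re s \<ge> d" if "s \<in> cball x d" for s
  proof -
    have "\<bar>Re (x - s)\<bar> \<le> d" using that abs_Re_le_cmod[of "x - s"] by (simp add: dist_norm)
    then have "Re x - Re s \<le> d" by (simp add: abs_le_iff)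
    then show ?thesis by (simp add: d_def)
  qed
  define A where "A = norm x + d"
  have bd: "norm (zeta_term n s) \<le> A * (A + 1) * real (Suc n) powr (-1 - d)" if s: "s \<in> cball x d" for n s
  proof -
    have "norm s \<le> A"
      using s norm_triangle_ineq4[of x "x - s"] by (simp add: A_def dist_norm)
    moreover have "norm (s - 1) \<le> norm s + 1" using norm_triangle_ineq4[of s 1] by simp
    moreover have "real (Suc n) powr (-1 - Re s) \<le> real (Suc n) powr (-1 - d)"
      using Re[OF s] by (intro powr_mono) auto
    ultimately have "norm s * norm (s - 1) * real (Suc n) powr (-1 - Re s) \<le> A * (A + 1) * real (Suc n) powr (-1 - d)"
      by (intro mult_mono) (auto simp: A_def d less_imp_le)
    then show ?thesis using norm_zeta_term_le[of s n] Re[OF s] d by linarith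
  qed
  have "summable (\<lambda>n. real (Suc n) powr (-1 - d))"
    using d by (subst summable_Suc_iff[of "\<lambda>n. real n powr (-1 - d)"]) (simp add: summable_real_powr_iff)
  then have "summable (\<lambda>n. A * (A + 1) * real (Suc n) powr (-1 - d))"
    by (intro summable_mult)
  then have "uniform_limit (cball x d) (\<lambda>n s. \<Sum>i<n. zeta_term i s) (\<lambda>s. \<Sum>i. zeta_term i s) sequentially"
    by (intro Weierstrass_m_test[where M = "\<lambda>n. A * (A + 1) * real (Suc n) powr (-1 - d)"] bd)
  then have "uniform_limit (cball x d) (\<lambda>n s. 1 + (\<Sum>i<n. zeta_term i s)) reg_zeta sequentially"
    unfolding reg_zeta_def by (intro uniform_limit_intros)
  then show "\<exists>d>0. cball x d \<subseteq> {s. Re s > 0} \<and>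
      uniform_limit (cball x d) (\<lambda>n s. 1 + (\<Sum>i<n. zeta_term i s)) reg_zeta sequentially"
    using d Re by (intro exI[of _ d]) force
qed

text \<open>Every \<open>zeta_term\<close> vanishes at 1; the value records that zeta has residue 1
  at its pole.\<close>

lemma reg_zeta_1: "reg_zeta 1 = 1"
  by (simp add: reg_zeta_def zeta_term_def del: of_nat_Suc)

text \<open>The powers with exponent \<open>1 - s\<close> telescope to \<open>-1\<close>, which
  cancels the leading 1 of \<open>reg_zeta\<close>.\<close>

lemma reg_zeta_eq:
  assumes s: "Re s > 1"
  shows "reg_zeta s = (s - 1) * dirichlet_zeta s"
proof -
  have "(\<lambda>n. of_nat n powr (1 - s) :: complex) \<longlonglongrightarrow> 0"
    using tendsto_neg_powr_complex_of_nat[of "\<lambda>n. n" sequentially "1 - s"] filterlim_ident[of sequentially] s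
    by simp
  then have "(\<lambda>n. of_nat (Suc n) powr (1 - s) :: complex) \<longlonglongrightarrow> 0"
    by (rule LIMSEQ_Suc)
  from telescope_sums'[OF this]
  have t: "(\<lambda>n. of_nat (Suc n) powr (1 - s) - of_nat (Suc (Suc n)) powr (1 - s)) sums (1 :: complex)"
    by simp
  have "(\<lambda>n. of_nat n powr (-s)) sums dirichlet_zeta s"
    unfolding dirichlet_zeta_def using summable_nat_powr(2)[OF s] by (rule summable_sums)
  then have "(\<lambda>n. of_nat (Suc n) powr (-s)) sums dirichlet_zeta s"
    by (subst sums_Suc_iff) simp
  then have "(\<lambda>n. (s - 1) * of_nat (Suc n) powr (-s)) sums ((s - 1) * dirichlet_zeta s)"
    by (rule sums_mult)
  from sums_diff[OF this t] have "(\<lambda>n. zeta_term n s) sums ((s - 1) * dirichlet_zeta s - 1)"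
    by (simp add: zeta_term_def algebra_simps)
  then show ?thesis by (simp add: reg_zeta_def sums_iff)
qed

section \<open>Moebius inversion and the Dirichlet series of the Moebius function\<close>

lemma nat_powr_mult:
  "(of_nat (m * n) :: complex) powr s = of_nat m powr s * of_nat n powr s"
  using powr_times_real[of "of_nat m" "of_nat n" s] by simp

lemma moebius_mult_prime:
  assumes p: "prime p" and d: "\<not> p dvd d"
  shows "moebius (p * d) = - moebius d"
proof (cases "d = 0 \<or> \<not> squarefree d")
  case True
  then have "d = 0 \<or> \<not> squarefree (p * d)"
    using squarefree_multD(2) by blast
  then show ?thesis using True by (auto simp: moebius_def)
next
  case False
  have cop: "coprime p d" using p d by (simp add: prime_imp_coprime)
  then have "squarefree (p * d)"
    using False p by (simp add: squarefree_mult_coprime squarefree_prime)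
  moreover have "prime_factors (p * d) = insert p (prime_factors d)"
    using False p by (simp add: prime_factors_product prime_gt_0_nat prime_prime_factors)
  moreover have "p \<notin> prime_factors d" using d by auto
  ultimately show ?thesis using False p by (auto simp: moebius_def prime_gt_0_nat)
qed

text \<open>Fix a prime \<open>p\<close> dividing \<open>n\<close>. Divisors \<open>d\<close> not
  divisible by \<open>p\<close> cancel against \<open>p * d\<close>, and the remaining divisors are
  divisible by the square of \<open>p\<close>.\<close>

lemma sum_moebius_divisors:
  assumes n: "n > 0"
  shows "(\<Sum>d | d dvd n. moebius d) = (if n = 1 then 1 else 0)"
proof (cases "n = 1")
  case True
  then show ?thesis by (simp add: moebius_def)
next
  case False
  then obtain p where p: "prime p" "p dvd n" using prime_factor_nat by blast
  let ?A = "{d. d dvd n \<and> \<not> p dvd d}"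
  have fin: "finite {d. d dvd n}" using n by simp
  have finA: "finite ?A" by (rule finite_subset[OF _ fin]) auto
  have "p * d dvd n" if "d \<in> ?A" for d
    using that p by (intro divides_mult) (auto simp: prime_imp_coprime)
  then have sub: "(*) p ` ?A \<subseteq> {d. d dvd n}" by auto
  have "(\<Sum>d | d dvd n. moebius d) = (\<Sum>d \<in> ?A \<union> (*) p ` ?A. moebius d)"
  proof (rule sum.mono_neutral_right[OF fin])
    show "\<forall>d\<in>{d. d dvd n} - (?A \<union> (*) p ` ?A). moebius d = 0"
    proof
      fix d assume d: "d \<in> {d. d dvd n} - (?A \<union> (*) p ` ?A)"
      then obtain e where e: "d = p * e" by auto
      with d have "p dvd e" by (auto intro: dvd_mult_left dvd_mult_right)
      then have "p\<^sup>2 dvd d" unfolding e power2_eq_square by (rule mult_dvd_mono[OF dvd_refl])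
      then have "\<not> squarefree d" using p unfolding squarefree_def by (metis not_prime_unit)
      then show "moebius d = 0" by (simp add: moebius_def)
    qed
  qed (use sub in auto)
  also have "\<dots> = (\<Sum>d\<in>?A. moebius d) + (\<Sum>d\<in>(*) p ` ?A. moebius d)"
    using finA by (intro sum.union_disjoint) auto
  also have "(\<Sum>d\<in>(*) p ` ?A. moebius d) = (\<Sum>d\<in>?A. moebius (p * d))"
    using p by (subst sum.reindex) (auto simp: inj_on_def prime_gt_0_nat)
  also have "\<dots> = (\<Sum>d\<in>?A. - moebius d)"
    by (intro sum.cong refl moebius_mult_prime p) auto
  finally show ?thesis using False by (simp add: sum_negf)
qed

text \<open>Absolute convergence allows the product, a double series over \<open>(m, n)\<close>, to
  be regrouped by \<open>k = m * n\<close>; the divisor sums of \<open>moebius\<close> leave only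
  \<open>k = 1\<close>.\<close>

lemma moebius_dirichlet_series:
  assumes s: "Re s > 1"
  shows "\<exists>M. (\<lambda>n. of_real (moebius n) * of_nat n powr (-s)) sums M \<and> M * dirichlet_zeta s = 1"
proof -
  define g :: "nat \<Rightarrow> complex" where "g = (\<lambda>n. of_nat n powr (-s))"
  define f :: "nat \<Rightarrow> complex" where "f = (\<lambda>n. of_real (moebius n) * g n)"
  \<comment> \<open>Index 0 is removed: its terms vanish, but every number divides 0, so its divisor
    set would be infinite.\<close>
  define A where "A = {1::nat..}"
  have gs: "summable (\<lambda>n. norm (g n))" unfolding g_def using summable_nat_powr(1)[OF s] .
  have "norm (f n) \<le> norm (g n)" for n
    using norm_moebius_le_1[of n] by (simp add: f_def norm_mult mult_left_le_one_le)
  then have fs: "summable (\<lambda>n. norm (f n))"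
    using summable_comparison_test[OF _ gs, of "\<lambda>n. norm (f n)"] by auto
  define M where "M = suminf f"
  have fM: "f sums M" unfolding M_def using fs summable_norm_cancel summable_sums by blast
  have gZ: "g sums dirichlet_zeta s"
    unfolding g_def dirichlet_zeta_def using summable_nat_powr(2)[OF s] by (rule summable_sums)
  have "(f has_sum M) UNIV" by (rule norm_summable_imp_has_sum[OF fs fM])
  then have f1: "(f has_sum M) A"
    by (rule has_sum_cong_neutral[THEN iffD1, rotated -1]) (auto simp: A_def f_def g_def)
  have "(g has_sum dirichlet_zeta s) UNIV" by (rule norm_summable_imp_has_sum[OF gs gZ])
  then have g1: "(g has_sum dirichlet_zeta s) A"
    by (rule has_sum_cong_neutral[THEN iffD1, rotated -1]) (auto simp: A_def g_def)
  have fn: "(\<lambda>n. norm (f n)) summable_on A"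
    using summable_on_subset[OF norm_summable_imp_summable_on[of "\<lambda>n. norm (f n)"], of A] fs by auto
  have gn: "(\<lambda>n. norm (g n)) summable_on A"
    using summable_on_subset[OF norm_summable_imp_summable_on[of "\<lambda>n. norm (g n)"], of A] gs by auto
  have "(\<lambda>(m, n). f m * g n) summable_on A \<times> A"
  proof (rule abs_summable_summable, rule summable_on_SigmaI)
    show "((\<lambda>n. norm (case (m, n) of (m, n) \<Rightarrow> f m * g n)) has_sum norm (f m) * infsum (\<lambda>n. norm (g n)) A) A" for m
      using has_sum_cmult_right[OF has_sum_infsum[OF gn], of "norm (f m)"] by (simp add: norm_mult)
    show "(\<lambda>m. norm (f m) * infsum (\<lambda>n. norm (g n)) A) summable_on A"
      by (rule summable_on_cmult_left[OF fn])
  qed auto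
  then have "((\<lambda>(m, n). f m * g n) has_sum M * dirichlet_zeta s) (A \<times> A)"
    using has_sum_cmult_right[OF g1] has_sum_cmult_left[OF f1]
    by (intro has_sum_SigmaI[where g = "\<lambda>m. f m * dirichlet_zeta s"]) auto
  also have "?this \<longleftrightarrow> ((\<lambda>(k, d). of_real (moebius d) * g k) has_sum M * dirichlet_zeta s)
      (SIGMA k:A. {d. d dvd k})"
    by (rule has_sum_reindex_bij_witness[where i = "\<lambda>(k, d). (d, k div d)" and j = "\<lambda>(m, n). (m * n, m)"])
       (auto simp: A_def f_def g_def nat_powr_mult Suc_le_eq dvd_div_eq_0_iff simp flip: of_nat_mult intro: dvd_pos_nat)
  finally have "((\<lambda>k. (\<Sum>d | d dvd k. of_real (moebius d) * g k)) has_sum M * dirichlet_zeta s) A"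
    by (rule has_sum_SigmaD) (auto simp: A_def)
  also have "?this \<longleftrightarrow> ((\<lambda>k. if k = 1 then 1 else 0) has_sum M * dirichlet_zeta s) A"
  proof (rule has_sum_cong)
    fix k assume k: "k \<in> A"
    have "(\<Sum>d | d dvd k. of_real (moebius d) * g k) = of_real (\<Sum>d | d dvd k. moebius d) * g k"
      by (simp add: sum_distrib_right)
    also have "\<dots> = of_real (if k = 1 then 1 else 0) * g k"
      using k by (subst sum_moebius_divisors) (auto simp: A_def)
    finally show "(\<Sum>d | d dvd k. of_real (moebius d) * g k) = (if k = 1 then 1 else 0)"
      by (simp add: g_def)
  qed
  finally have "((\<lambda>k. if k = 1 then 1 else 0) has_sum M * dirichlet_zeta s) A" .
  moreover have "((\<lambda>k. if k = 1 then 1 else 0) has_sum (1::complex)) A"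
    by (rule has_sum_finite_neutralI[of "{1}"]) (auto simp: A_def)
  ultimately have "M * dirichlet_zeta s = 1" using has_sum_unique by blast
  then show ?thesis using fM unfolding f_def g_def by blast
qed

section \<open>Euler product and non-vanishing of zeta on the line Re s = 1\<close>

text \<open>The sieve of Eratosthenes: the multiples of a new prime \<open>p\<close> among the
  surviving integers are \<open>p * m\<close> with \<open>m\<close> surviving, so they contribute
  \<open>p powr (-s)\<close> times the current sum.\<close>

lemma euler_product_finite:
  assumes s: "Re s > 1" and Q: "finite Q" "\<And>p. p \<in> Q \<Longrightarrow> prime p"
  shows "((\<lambda>n. if \<exists>p\<in>Q. p dvd n then 0 else of_nat n powr (-s)) has_sum
           dirichlet_zeta s * (\<Prod>p\<in>Q. 1 - of_nat p powr (-s))) UNIV"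
  using Q
proof (induction Q rule: finite_induct)
  case empty
  have "(\<lambda>n. of_nat n powr (-s)) sums dirichlet_zeta s"
    unfolding dirichlet_zeta_def using summable_nat_powr(2)[OF s] by (rule summable_sums)
  then show ?case
    using norm_summable_imp_has_sum[OF summable_nat_powr(1)[OF s]] by simp
next
  case (insert p Q)
  define h :: "nat \<Rightarrow> complex" where "h = (\<lambda>n. if \<exists>p\<in>Q. p dvd n then 0 else of_nat n powr (-s))"
  define V where "V = dirichlet_zeta s * (\<Prod>p\<in>Q. 1 - of_nat p powr (-s))"
  have p: "prime p" and Q: "\<And>q. q \<in> Q \<Longrightarrow> prime q" using insert by auto
  have hV: "(h has_sum V) UNIV" unfolding h_def V_def using insert Q by auto
  have q_dvd: "q dvd p * m \<longleftrightarrow> q dvd m" if "q \<in> Q" for q m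
    using that Q[OF that] p insert(2) by (metis primes_dvd_imp_eq dvd_mult prime_dvd_mult_iff)
  have "((\<lambda>m. of_nat p powr (-s) * h m) has_sum of_nat p powr (-s) * V) UNIV"
    by (rule has_sum_cmult_right[OF hV])
  also have "(\<lambda>m. of_nat p powr (-s) * h m) = h \<circ> (\<lambda>m. p * m)"
    using q_dvd by (auto simp: h_def fun_eq_iff nat_powr_mult simp del: of_nat_mult)
  also have "((h \<circ> (\<lambda>m. p * m)) has_sum of_nat p powr (-s) * V) UNIV \<longleftrightarrow>
      (h has_sum of_nat p powr (-s) * V) (range (\<lambda>m. p * m))"
    using p by (intro has_sum_reindex[symmetric]) (auto simp: inj_on_def prime_gt_0_nat)
  also have "\<dots> \<longleftrightarrow> ((\<lambda>n. if p dvd n then h n else 0) has_sum of_nat p powr (-s) * V) UNIV"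
    by (rule has_sum_cong_neutral) (auto simp: dvd_def)
  finally have "((\<lambda>n. h n + - (if p dvd n then h n else 0)) has_sum V + - (of_nat p powr (-s) * V)) UNIV"
    by (intro has_sum_add hV has_sum_uminusI)
  then have "((\<lambda>n. h n - (if p dvd n then h n else 0)) has_sum V - of_nat p powr (-s) * V) UNIV"
    by simp
  moreover have "(\<lambda>n. h n - (if p dvd n then h n else 0)) =
      (\<lambda>n. if \<exists>q\<in>insert p Q. q dvd n then 0 else of_nat n powr (-s))"
    by (auto simp: h_def fun_eq_iff)
  moreover have "V - of_nat p powr (-s) * V = dirichlet_zeta s * (\<Prod>q\<in>insert p Q. 1 - of_nat q powr (-s))"
    using insert by (simp add: V_def algebra_simps)
  ultimately show ?case by simp
qed

text \<open>Once the primes up to \<open>N\<close> are sieved out, only 1 and integers above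
  \<open>N\<close> survive, so the error is at most a tail of an absolutely convergent
  series.\<close>

lemma euler_product:
  assumes s: "Re s > 1"
  shows "(\<lambda>N. dirichlet_zeta s * (\<Prod>p | prime p \<and> p \<le> N. 1 - of_nat p powr (-s))) \<longlonglongrightarrow> 1"
proof (rule LIM_zero_cancel, rule Lim_null_comparison)
  let ?b = "\<lambda>n. norm (of_nat n powr (-s) :: complex)"
  show "(\<lambda>N. \<Sum>k. ?b (k + Suc N)) \<longlonglongrightarrow> 0"
    using LIMSEQ_Suc[OF suminf_exist_split2[OF summable_nat_powr(1)[OF s]]] by simp
  show "\<forall>\<^sub>F N in sequentially. norm (dirichlet_zeta s * (\<Prod>p | prime p \<and> p \<le> N. 1 - of_nat p powr (-s)) - 1)
      \<le> (\<Sum>k. ?b (k + Suc N))"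
    using eventually_ge_at_top[of 1]
  proof eventually_elim
    case (elim N)
    define h :: "nat \<Rightarrow> complex" where
      "h = (\<lambda>n. (if \<exists>p\<in>{p. prime p \<and> p \<le> N}. p dvd n then 0 else of_nat n powr (-s)) - (if n = 1 then 1 else 0))"
    have h_le: "norm (h n) \<le> ?b n" if "n > 1" for n using that by (auto simp: h_def)
    have h0: "h n = 0" if "n < Suc N" for n
    proof -
      consider "n = 0" | "n = 1" | "n > 1" by linarith
      then show ?thesis
      proof cases
        case 3
        then obtain p where "prime p" "p dvd n" using prime_factor_nat[of n] by auto
        moreover have "p \<le> N" using dvd_imp_le[OF \<open>p dvd n\<close>] 3 that by linarith
        ultimately show ?thesis using 3 by (auto simp: h_def)
      qed (auto simp: h_def)
    qed
    have "(\<lambda>n. (if \<exists>p\<in>{p. prime p \<and> p \<le> N}. p dvd n then 0 else of_nat n powr (-s))) sums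
        (dirichlet_zeta s * (\<Prod>p | prime p \<and> p \<le> N. 1 - of_nat p powr (-s)))"
      by (intro has_sum_imp_sums euler_product_finite s) auto
    then have "h sums (dirichlet_zeta s * (\<Prod>p | prime p \<and> p \<le> N. 1 - of_nat p powr (-s)) - 1)"
      unfolding h_def using sums_single[of 1 "\<lambda>_. 1::complex"] by (intro sums_diff) auto
    then have "(\<lambda>k. h (k + Suc N)) sums (dirichlet_zeta s * (\<Prod>p | prime p \<and> p \<le> N. 1 - of_nat p powr (-s)) - 1)"
      using h0 by (subst sums_iff_shift) simp
    then have eq: "dirichlet_zeta s * (\<Prod>p | prime p \<and> p \<le> N. 1 - of_nat p powr (-s)) - 1 = (\<Sum>k. h (k + Suc N))"
      by (simp add: sums_iff)
    have sb: "summable (\<lambda>k. ?b (k + Suc N))"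
      using summable_nat_powr(1)[OF s] by (subst summable_iff_shift)
    have le: "norm (h (k + Suc N)) \<le> ?b (k + Suc N)" for k using elim by (intro h_le) auto
    show ?case
      unfolding eq using sb le by (intro norm_suminf_le) auto
  qed
qed

text \<open>This is \<open>3 + 4 * cos t + cos (2 * t) = 2 * (1 + cos t)\<^sup>2\<close> applied to each term of the
  logarithmic series.\<close>

lemma three_four_one_local:
  fixes w :: complex
  assumes x: "0 \<le> x" "x < 1" and w: "norm w = 1"
  shows "norm (1 - of_real x :: complex) ^ 3 * norm (1 - of_real x * w) ^ 4 * norm (1 - of_real x * w\<^sup>2) \<le> 1"
proof -
  \<comment> \<open>Real part of the logarithmic series; the summand at \<open>n = 0\<close> is 0 by
    division by 0.\<close>
  have ser: "(\<lambda>n. - Re (z ^ n) / real n) sums ln (norm (1 - z))" and nz: "norm (1 - z) > 0"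
    if "norm z < 1" for z :: complex
  proof -
    have "1 - z \<noteq> 0" using that by auto
    then show "norm (1 - z) > 0" by simp
    have "(\<lambda>n. Re (- (z ^ n) / of_nat n)) sums Re (ln (1 - z))"
      using Ln_series'[of "-z"] that by (intro sums_Re) auto
    moreover have "Re (ln (1 - z)) = ln (norm (1 - z))"
      using \<open>1 - z \<noteq> 0\<close> by simp
    ultimately show "(\<lambda>n. - Re (z ^ n) / real n) sums ln (norm (1 - z))"
      by simp
  qed
  have n: "norm (of_real x :: complex) < 1" "norm (of_real x * w) < 1" "norm (of_real x * w\<^sup>2) < 1"
    using x w by (auto simp: norm_mult norm_power)
  let ?L = "3 * ln (norm (1 - of_real x :: complex)) + 4 * ln (norm (1 - of_real x * w)) + ln (norm (1 - of_real x * w\<^sup>2))"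
  have "(\<lambda>n. 3 * (- Re (of_real x ^ n) / real n) + 4 * (- Re ((of_real x * w) ^ n) / real n)
      + (- Re ((of_real x * w\<^sup>2) ^ n) / real n)) sums ?L"
    using n by (intro sums_add sums_mult ser)
  moreover have "3 * (- Re (of_real x ^ n) / real n) + 4 * (- Re ((of_real x * w) ^ n) / real n)
      + (- Re ((of_real x * w\<^sup>2) ^ n) / real n) \<le> 0" for n
  proof -
    define c where "c = Re (w ^ n)"
    have "(Re (w ^ n))\<^sup>2 + (Im (w ^ n))\<^sup>2 = 1"
      using cmod_power2[of "w ^ n"] w by (simp add: norm_power)
    then have "Re ((w ^ n)\<^sup>2) = 2 * c\<^sup>2 - 1" by (simp add: c_def Re_power2)
    moreover have "(w\<^sup>2) ^ n = (w ^ n)\<^sup>2" by (simp add: power_mult[symmetric] mult.commute)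
    ultimately have c2: "Re ((w\<^sup>2) ^ n) = 2 * c\<^sup>2 - 1" by simp
    have "3 * (- Re (of_real x ^ n) / real n) + 4 * (- Re ((of_real x * w) ^ n) / real n)
      + (- Re ((of_real x * w\<^sup>2) ^ n) / real n) = - (x ^ n / real n) * (2 * (1 + c)\<^sup>2)"
    proof -
      have v: "Re ((of_real x * v) ^ n) = x ^ n * Re (v ^ n)" for v
        by (simp add: power_mult_distrib flip: of_real_power)
      have "Re (of_real x ^ n) = x ^ n" by (simp flip: of_real_power)
      then show ?thesis
        unfolding v c2 c_def[symmetric]
        by (simp add: power2_eq_square add_divide_distrib diff_divide_distrib algebra_simps)
    qed
    also have "\<dots> \<le> 0" using x by (simp add: mult_nonneg_nonneg)
    finally show ?thesis .
  qed
  ultimately have "?L \<le> 0" by (rule sums_le[OF _ _ sums_zero, rotated])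
  moreover have "?L = ln (norm (1 - of_real x :: complex) ^ 3 * norm (1 - of_real x * w) ^ 4 * norm (1 - of_real x * w\<^sup>2))"
    using nz[OF n(1)] nz[OF n(2)] nz[OF n(3)] by (simp add: ln_mult ln_realpow)
  ultimately show ?thesis
    using nz[OF n(1)] nz[OF n(2)] nz[OF n(3)] by (simp add: ln_le_zero_iff)
qed

text \<open>For finite Euler products \<open>three_four_one_local\<close> applies to each prime with
  \<open>x = p powr (-\<sigma>)\<close> and \<open>w\<close> the unimodular part. Multiplying by the
  zeta values gives a quantity that tends to 1 and never exceeds the left-hand side.\<close>

lemma three_four_one:
  fixes \<sigma> t :: real
  assumes "\<sigma> > 1"
  shows "norm (dirichlet_zeta (of_real \<sigma>)) ^ 3 * norm (dirichlet_zeta (of_real \<sigma> + \<i> * of_real t)) ^ 4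
     * norm (dirichlet_zeta (of_real \<sigma> + 2 * \<i> * of_real t)) \<ge> 1"
proof -
  let ?s0 = "complex_of_real \<sigma>" and ?s1 = "of_real \<sigma> + \<i> * of_real t" and ?s2 = "of_real \<sigma> + 2 * \<i> * of_real t"
  let ?P = "\<lambda>s N. \<Prod>p | prime p \<and> p \<le> N. 1 - of_nat p powr (-s) :: complex"
  have lim: "(\<lambda>N. norm (dirichlet_zeta ?s0 * ?P ?s0 N) ^ 3 * norm (dirichlet_zeta ?s1 * ?P ?s1 N) ^ 4
      * norm (dirichlet_zeta ?s2 * ?P ?s2 N)) \<longlonglongrightarrow> norm (1::complex) ^ 3 * norm (1::complex) ^ 4 * norm (1::complex)"
    using assms by (intro tendsto_intros euler_product) auto
  have le1: "norm (?P ?s0 N) ^ 3 * norm (?P ?s1 N) ^ 4 * norm (?P ?s2 N) \<le> 1" for N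
  proof -
    have "norm (?P ?s0 N) ^ 3 * norm (?P ?s1 N) ^ 4 * norm (?P ?s2 N) =
      (\<Prod>p | prime p \<and> p \<le> N. norm (1 - of_nat p powr (-?s0) :: complex) ^ 3
         * norm (1 - of_nat p powr (-?s1) :: complex) ^ 4 * norm (1 - of_nat p powr (-?s2) :: complex))"
      by (simp only: prod.distrib prod_norm[symmetric] prod_power_distrib)
    also have "\<dots> \<le> 1"
    proof (rule prod_le_1)
      fix p assume "p \<in> {p. prime p \<and> p \<le> N}"
      then have p: "p > 1" using prime_gt_1_nat by blast
      define x where "x = real p powr (-\<sigma>)"
      define w :: complex where "w = of_nat p powr (- (\<i> * of_real t))"
      have x: "0 \<le> x" "x < 1" using p assms by (auto simp: x_def powr_less_one)
      have w: "norm w = 1" using p by (simp add: w_def norm_nat_powr)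
      have px: "of_nat p powr (-?s0) = complex_of_real x"
        using powr_of_real[of "real p" "-\<sigma>"] by (simp add: x_def)
      have "of_nat p powr (-?s1) = of_nat p powr (-?s0) * w"
        by (simp add: w_def powr_add[symmetric])
      moreover have "of_nat p powr (-?s2) = of_nat p powr (-?s0) * w\<^sup>2"
        by (simp add: w_def powr_add[symmetric] power2_eq_square algebra_simps)
      ultimately show "0 \<le> norm (1 - of_nat p powr (-?s0) :: complex) ^ 3
         * norm (1 - of_nat p powr (-?s1) :: complex) ^ 4 * norm (1 - of_nat p powr (-?s2) :: complex) \<and>
         norm (1 - of_nat p powr (-?s0) :: complex) ^ 3
         * norm (1 - of_nat p powr (-?s1) :: complex) ^ 4 * norm (1 - of_nat p powr (-?s2) :: complex) \<le> 1"
        using three_four_one_local[OF x w] px by simp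
    qed
    finally show ?thesis .
  qed
  let ?Z = "norm (dirichlet_zeta ?s0) ^ 3 * norm (dirichlet_zeta ?s1) ^ 4 * norm (dirichlet_zeta ?s2)"
  have "norm (dirichlet_zeta ?s0 * ?P ?s0 N) ^ 3 * norm (dirichlet_zeta ?s1 * ?P ?s1 N) ^ 4
      * norm (dirichlet_zeta ?s2 * ?P ?s2 N) \<le> ?Z" for N
  proof -
    have "norm (dirichlet_zeta ?s0 * ?P ?s0 N) ^ 3 * norm (dirichlet_zeta ?s1 * ?P ?s1 N) ^ 4
      * norm (dirichlet_zeta ?s2 * ?P ?s2 N) = ?Z * (norm (?P ?s0 N) ^ 3 * norm (?P ?s1 N) ^ 4 * norm (?P ?s2 N))"
      by (simp add: norm_mult power_mult_distrib mult_ac)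
    also have "\<dots> \<le> ?Z * 1" by (intro mult_left_mono le1) auto
    finally show ?thesis by simp
  qed
  with lim have "norm (1::complex) ^ 3 * norm (1::complex) ^ 4 * norm (1::complex) \<le> ?Z"
    by (intro tendsto_upperbound[OF lim]) auto
  then show ?thesis by simp
qed

text \<open>A zero at \<open>1 + i t\<close> would have weight 4 against weight 3 for the pole at 1,
  so the product in \<open>three_four_one\<close> would tend to 0 as \<open>s\<close> approaches the
  line. The pole is absorbed into \<open>reg_zeta\<close>, which leaves one explicit factor
  \<open>h\<close>.\<close>

lemma reg_zeta_nonzero_on_line:
  fixes t :: real
  assumes t: "t \<noteq> 0"
  shows "reg_zeta (1 + \<i> * of_real t) \<noteq> 0"
proof
  assume zero: "reg_zeta (1 + \<i> * of_real t) = 0"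
  let ?Z = reg_zeta
  have an: "(?Z has_field_derivative deriv ?Z s) (at s)" if "Re s > 0" for s
    using holomorphic_derivI[OF holomorphic_reg_zeta open_halfspace_Re_gt[of 0]] that by simp
  have cont: "isCont ?Z s" if "Re s > 0" for s
    using an[OF that] by (rule DERIV_isCont)
  have path: "((\<lambda>h. 1 + of_real h + w) \<longlongrightarrow> 1 + w) (at_right 0)" for w :: complex
    by (rule tendsto_eq_intros refl | simp)+
  have limZ: "((\<lambda>h. ?Z (1 + of_real h + w)) \<longlongrightarrow> ?Z (1 + w)) (at_right 0)" if "Re w = 0" for w
    by (rule isCont_tendsto_compose[OF cont path]) (use that in simp)
  have quot: "((\<lambda>h. ?Z (1 + of_real h + \<i> * of_real t) / of_real h) \<longlongrightarrow> deriv ?Z (1 + \<i> * of_real t)) (at_right 0)"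
  proof -
    have "((\<lambda>h. (?Z (1 + \<i> * of_real t + h) - ?Z (1 + \<i> * of_real t)) / h) \<longlongrightarrow> deriv ?Z (1 + \<i> * of_real t)) (at 0)"
      using an[of "1 + \<i> * of_real t"] by (simp add: DERIV_def)
    moreover have "filterlim (\<lambda>h. complex_of_real h) (at 0) (at_right 0)"
      unfolding filterlim_at
      by (auto simp: eventually_at_filter intro!: tendsto_eq_intros)
    ultimately show ?thesis
      by (auto dest: filterlim_compose simp: zero algebra_simps)
  qed
  have "((\<lambda>h. norm (?Z (1 + of_real h + 0)) ^ 3 * norm (?Z (1 + of_real h + \<i> * of_real t) / of_real h) ^ 4
      * norm (?Z (1 + of_real h + 2 * \<i> * of_real t)) * h) \<longlongrightarrow>
      norm (?Z (1 + 0)) ^ 3 * norm (deriv ?Z (1 + \<i> * of_real t)) ^ 4 * norm (?Z (1 + 2 * \<i> * of_real t)) * 0) (at_right 0)"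
    by (intro tendsto_intros limZ quot) auto
  then have lim0: "((\<lambda>h. norm (?Z (1 + of_real h)) ^ 3 * norm (?Z (1 + of_real h + \<i> * of_real t) / of_real h) ^ 4
      * norm (?Z (1 + of_real h + 2 * \<i> * of_real t)) * h) \<longlongrightarrow> 0) (at_right 0)"
    by simp
  have "\<bar>t\<bar> ^ 4 * (2 * \<bar>t\<bar>) \<le> norm (?Z (1 + of_real h)) ^ 3 * norm (?Z (1 + of_real h + \<i> * of_real t) / of_real h) ^ 4
      * norm (?Z (1 + of_real h + 2 * \<i> * of_real t)) * h" if h: "h > 0" for h :: real
  proof -
    let ?z0 = "norm (dirichlet_zeta (1 + of_real h))" and ?z1 = "norm (dirichlet_zeta (1 + of_real h + \<i> * of_real t))"
      and ?z2 = "norm (dirichlet_zeta (1 + of_real h + 2 * \<i> * of_real t))"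
    have Zw: "norm (?Z (1 + of_real h + w)) = norm (of_real h + w) * norm (dirichlet_zeta (1 + of_real h + w))"
      if "Re w = 0" for w
    proof -
      have "1 + of_real h + w - 1 = of_real h + w" by simp
      then show ?thesis using reg_zeta_eq[of "1 + of_real h + w"] h that by (simp add: norm_mult)
    qed
    have e: "norm (?Z (1 + of_real h)) = h * ?z0"
      "norm (?Z (1 + of_real h + \<i> * of_real t)) = norm (of_real h + \<i> * of_real t) * ?z1"
      "norm (?Z (1 + of_real h + 2 * \<i> * of_real t)) = norm (of_real h + 2 * \<i> * of_real t) * ?z2"
      using h Zw[of 0] Zw[of "\<i> * of_real t"] Zw[of "2 * \<i> * of_real t"] by simp_all
    have "\<bar>Im (of_real h + \<i> * of_real t)\<bar> \<le> norm (of_real h + \<i> * of_real t)" by (rule abs_Im_le_cmod)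
    then have n1: "\<bar>t\<bar> \<le> norm (of_real h + \<i> * of_real t)" by simp
    have "\<bar>Im (of_real h + 2 * \<i> * of_real t)\<bar> \<le> norm (of_real h + 2 * \<i> * of_real t)" by (rule abs_Im_le_cmod)
    then have n2: "2 * \<bar>t\<bar> \<le> norm (of_real h + 2 * \<i> * of_real t)" by simp
    have "?z0 ^ 3 * ?z1 ^ 4 * ?z2 \<ge> 1"
      using three_four_one[of "1 + h" t] h by simp
    then have "(\<bar>t\<bar> ^ 4 * (2 * \<bar>t\<bar>)) * 1 \<le> (norm (of_real h + \<i> * of_real t) ^ 4 * norm (of_real h + 2 * \<i> * of_real t))
        * (?z0 ^ 3 * ?z1 ^ 4 * ?z2)"
      by (intro mult_mono power_mono n1 n2) auto
    \<comment> \<open>The powers of \<open>h\<close> cancel: three from \<open>?Z\<close> near 1,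
      minus four from the quotients, plus the explicit factor.\<close>
    also have "\<dots> = norm (?Z (1 + of_real h)) ^ 3 * norm (?Z (1 + of_real h + \<i> * of_real t) / of_real h) ^ 4
      * norm (?Z (1 + of_real h + 2 * \<i> * of_real t)) * h"
      using h unfolding norm_divide e
      by (simp add: field_simps power_mult_distrib power_divide power3_eq_cube power4_eq_xxxx)
    finally show ?thesis by simp
  qed
  then have "\<forall>\<^sub>F h in at_right 0. \<bar>t\<bar> ^ 4 * (2 * \<bar>t\<bar>) \<le> norm (?Z (1 + of_real h)) ^ 3 * norm (?Z (1 + of_real h + \<i> * of_real t) / of_real h) ^ 4
      * norm (?Z (1 + of_real h + 2 * \<i> * of_real t)) * h"
    by (auto simp: eventually_at_filter)
  from tendsto_lowerbound[OF lim0 this] have "\<bar>t\<bar> ^ 4 * (2 * \<bar>t\<bar>) \<le> 0" by simp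
  moreover have "\<bar>t\<bar> ^ 4 * (2 * \<bar>t\<bar>) > 0" using t by simp
  ultimately show False by linarith
qed

lemma reg_zeta_nonzero:
  assumes "Re s \<ge> 1"
  shows "reg_zeta s \<noteq> 0"
proof (cases "Re s > 1")
  case True
  then have "dirichlet_zeta s \<noteq> 0" using moebius_dirichlet_series[of s] by auto
  then show ?thesis using True by (auto simp: reg_zeta_eq)
next
  case False
  then have s: "s = 1 + \<i> * of_real (Im s)" using assms by (simp add: complex_eq_iff)
  show ?thesis
  proof (cases "Im s = 0")
    case True
    then show ?thesis using s by (simp add: reg_zeta_1)
  next
    case False
    then show ?thesis using reg_zeta_nonzero_on_line s by metis
  qed
qed

subsection \<open>The Moebius function has mean zero\<close>

text \<open>Newman's theorem with \<open>F z = z / reg_zeta (1 + z)\<close>, which is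
  \<open>1 / zeta\<close> at \<open>1 + z\<close> with the pole of zeta turned into a zero at
  \<open>z = 0\<close>. The translated non-vanishing set \<open>U\<close> contains the closed half
  plane by \<open>reg_zeta_nonzero\<close>.\<close>

lemma moebius_over_n_summable: "summable (\<lambda>n. of_real (moebius n) / of_nat n :: complex)"
proof -
  define U where "U = (\<lambda>s. s - 1) ` {s. Re s > 0 \<and> reg_zeta s \<noteq> 0}"
  define F where "F = (\<lambda>z. z / reg_zeta (1 + z))"
  have cont: "continuous_on {s. Re s > 0} reg_zeta"
    using holomorphic_reg_zeta by (rule holomorphic_on_imp_continuous_on)
  have "open {s \<in> {s. Re s > 0}. reg_zeta s \<in> - {0}}"
    using continuous_open_preimage[OF cont open_halfspace_Re_gt, of "- {0}"] open_delete[OF open_UNIV, of 0]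
    by (simp add: vimage_def Int_def Compl_eq_Diff_UNIV)
  then have "open {s. Re s > 0 \<and> reg_zeta s \<noteq> 0}" by simp
  then have U: "open U" unfolding U_def
    using open_translation_subtract by blast
  have mem_U: "z \<in> U \<longleftrightarrow> Re (1 + z) > 0 \<and> reg_zeta (1 + z) \<noteq> 0" for z
    unfolding U_def by (auto simp: image_iff) (metis add_diff_cancel_left' add_pos_pos one_complex.sel(1) plus_complex.sel(1))+
  have half: "{z. Re z \<ge> 0} \<subseteq> U"
    using reg_zeta_nonzero by (auto simp: mem_U)
  have "(\<lambda>z. reg_zeta (1 + z)) holomorphic_on U"
    by (rule holomorphic_on_compose_gen[OF _ holomorphic_reg_zeta, of "\<lambda>z. 1 + z" U, unfolded o_def])
       (intro holomorphic_intros, auto simp: mem_U)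
  then have F: "F holomorphic_on U"
    unfolding F_def by (intro holomorphic_intros) (auto simp: mem_U)
  have "(\<lambda>n. of_real (moebius n) * of_nat n powr (-1 - z)) sums F z" if z: "Re z > 0" for z
  proof -
    obtain M where M: "(\<lambda>n. of_real (moebius n) * of_nat n powr (- (1 + z))) sums M"
      "M * dirichlet_zeta (1 + z) = 1"
      using moebius_dirichlet_series[of "1 + z"] z by auto
    have "reg_zeta (1 + z) = z * dirichlet_zeta (1 + z)"
      using reg_zeta_eq[of "1 + z"] z by simp
    then have "F z = M" using M(2) z unfolding F_def
      by (metis (no_types, lifting) less_irrefl mult.commute mult_zero_left nonzero_divide_mult_cancel_left nonzero_eq_divide_eq zero_complex.sel(1) zero_neq_one)
    then show ?thesis using M(1) by (simp add: algebra_simps)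
  qed
  then have "(\<lambda>n. of_real (moebius n) / of_nat n) sums F 0"
    using norm_moebius_le_1 by (intro newman_tauberian[OF _ U half F]) auto
  then show ?thesis by (rule sums_summable)
qed

theorem moebius_mean_tendsto_0: "(\<lambda>N. (\<Sum>n=1..N. moebius n) / real N) \<longlonglongrightarrow> 0"
proof -
  have "(\<Sum>n=1..N. of_nat n * (of_real (moebius n) / of_nat n :: complex)) / of_nat N
      = of_real ((\<Sum>n=1..N. moebius n) / real N)" for N
    by simp
  then have "(\<lambda>N. complex_of_real ((\<Sum>n=1..N. moebius n) / real N)) \<longlonglongrightarrow> of_real 0"
    using kronecker_mean_tendsto_0[OF moebius_over_n_summable] by simp
  then show ?thesis by (simp only: tendsto_of_real_iff)
qed

subsection \<open>Contracting systems and the shift\<close>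

lemma shift_funpow: "((\<lambda>x n. x (Suc n)) ^^ k) x = (\<lambda>n. x (n + k))"
  by (induction k arbitrary: x) (auto simp: fun_eq_iff)

text \<open>The metric on functions sums the truncated coordinate distances with weights
  \<open>(1/2)^n\<close>, whose total is 2.\<close>

lemma dist_fun_le_of_coordinatewise:
  fixes x y :: "nat \<Rightarrow> real"
  assumes "\<And>n. dist (x n) (y n) \<le> c"
  shows "dist x y \<le> 2 * c"
proof -
  have c: "c \<ge> 0" using assms[of 0] zero_le_dist order_trans by blast
  have "dist x y = (\<Sum>n. (1/2)^n * min (dist (x (from_nat n)) (y (from_nat n))) 1)"
    by (simp add: dist_fun_def)
  also have "\<dots> \<le> (\<Sum>n. (1/2)^n * c)"
  proof (rule suminf_le)
    show "summable (\<lambda>n. (1/2)^n * min (dist (x (from_nat n)) (y (from_nat n))) (1::real))"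
      by (rule summable_comparison_test'[of "\<lambda>n. (1/2)^n"]) (auto simp: summable_geometric_iff)
    show "summable (\<lambda>n. (1/2::real)^n * c)"
      by (intro summable_mult2) (auto simp: summable_geometric_iff)
  qed (use assms in \<open>auto intro!: mult_left_mono simp: min.coboundedI1\<close>)
  also have "\<dots> = 2 * c"
    using suminf_mult2[of "\<lambda>n. (1/2::real)^n" c] suminf_geometric[of "1/2::real"]
    by (simp add: summable_geometric_iff)
  finally show ?thesis .
qed

text \<open>Tychonoff's theorem for the product of the intervals
  \<open>{- \<tau> n..\<tau> n}\<close>.\<close>

lemma compact_bounded_sequences:
  fixes \<tau> :: "nat \<Rightarrow> real"
  shows "compact {x. \<forall>n. \<bar>x n\<bar> \<le> \<tau> n}"
proof -
  have "compactin (product_topology (\<lambda>i::nat. euclidean::real topology) UNIV)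
          (PiE UNIV (\<lambda>n. {- \<tau> n..\<tau> n}))"
    by (simp add: compactin_PiE)
  moreover have "PiE UNIV (\<lambda>n. {- \<tau> n..\<tau> n}) = {x. \<forall>n. \<bar>x n\<bar> \<le> \<tau> n}"
    by (simp add: PiE_UNIV_domain Pi_def abs_le_iff minus_le_iff conj_commute)
  ultimately show ?thesis by (simp add: euclidean_product_topology)
qed

lemma continuous_on_funpow:
  fixes T :: "'a::topological_space \<Rightarrow> 'a"
  assumes "continuous_on X T" "T ` X \<subseteq> X"
  shows "continuous_on X (T ^^ k) \<and> (T ^^ k) ` X \<subseteq> X"
proof (induction k)
  case (Suc k)
  then have "continuous_on X (T \<circ> (T ^^ k))"
    using assms by (intro continuous_on_compose) (auto intro: continuous_on_subset)
  then show ?case using Suc assms by auto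
qed auto

text \<open>Orbits that contract uniformly can be separated only during a bounded initial
  time, so the cardinality of separated sets is bounded independently of the orbit length.\<close>

lemma topological_entropy_eq_0_if_contracting:
  fixes T :: "'a::metric_space \<Rightarrow> 'a"
  assumes X: "compact X" "X \<noteq> {}" and T: "continuous_on X T" "T ` X \<subseteq> X"
    and contr: "\<And>e. e > 0 \<Longrightarrow> \<exists>K. \<forall>k\<ge>K. \<forall>x\<in>X. \<forall>y\<in>X. dist ((T ^^ k) x) ((T ^^ k) y) \<le> e"
  shows "topological_entropy X T = 0"
proof -
  have "limsup (\<lambda>n. ereal (ln (max_separated X T n e) / real n)) = 0" if e: "e > 0" for e
  proof -
    obtain K where K: "\<And>k x y. k \<ge> K \<Longrightarrow> x \<in> X \<Longrightarrow> y \<in> X \<Longrightarrow> dist ((T ^^ k) x) ((T ^^ k) y) \<le> e"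
      using contr[OF e] by blast
    \<comment> \<open>Only finitely many iterates are involved, each uniformly continuous on the
      compact set, so one \<open>d\<close> serves them all.\<close>
    have "\<exists>d>0. \<forall>x\<in>X. \<forall>y\<in>X. dist x y < d \<longrightarrow> (\<forall>k<m. dist ((T ^^ k) x) ((T ^^ k) y) \<le> e)" for m
    proof (induction m)
      case 0 then show ?case by (auto intro!: exI[of _ 1])
    next
      case (Suc m)
      then obtain d1 where d1: "d1 > 0"
        "\<And>x y k. x \<in> X \<Longrightarrow> y \<in> X \<Longrightarrow> dist x y < d1 \<Longrightarrow> k < m \<Longrightarrow> dist ((T ^^ k) x) ((T ^^ k) y) \<le> e"
        by blast
      have "uniformly_continuous_on X (T ^^ m)"
        using X continuous_on_funpow[OF T] compact_uniformly_continuous by blast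
      then obtain d2 where d2: "d2 > 0"
        "\<And>x y. x \<in> X \<Longrightarrow> y \<in> X \<Longrightarrow> dist x y < d2 \<Longrightarrow> dist ((T ^^ m) x) ((T ^^ m) y) < e"
        unfolding uniformly_continuous_on_def using e by (metis dist_commute)
      show ?case
        using d1 d2 by (intro exI[of _ "min d1 d2"]) (auto simp: less_Suc_eq less_imp_le)
    qed
    then obtain d where d: "d > 0"
      "\<And>x y k. x \<in> X \<Longrightarrow> y \<in> X \<Longrightarrow> dist x y < d \<Longrightarrow> k < K \<Longrightarrow> dist ((T ^^ k) x) ((T ^^ k) y) \<le> e"
      by blast
    \<comment> \<open>Times below \<open>K\<close> are handled by \<open>d\<close>, later times by
      contraction: points closer than \<open>d\<close> are never separated.\<close>
    have near: "dist ((T ^^ k) x) ((T ^^ k) y) \<le> e" if "x \<in> X" "y \<in> X" "dist x y < d" for x y k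
      using d(2) K that by (cases "k < K") auto
    obtain C where C: "finite C" "X \<subseteq> (\<Union>x\<in>C. ball x (d/2))"
      using X(1) d(1) by (metis compact_eq_totally_bounded half_gt_zero)
    have card_le: "card E \<le> card C" if E: "separated_set X T n e E" for E n
    proof -
      have EX: "E \<subseteq> X" using E by (simp add: separated_set_def)
      then have "\<forall>x\<in>E. \<exists>c\<in>C. dist c x < d/2" using C(2) by fastforce
      then obtain h where h: "\<And>x. x \<in> E \<Longrightarrow> h x \<in> C \<and> dist (h x) x < d/2" by metis
      \<comment> \<open>Two points assigned to the same centre of the \<open>d/2\<close>-net are
        closer than \<open>d\<close>, so they cannot both lie in a separated set unless
        equal.\<close>
      have "inj_on h E"
      proof (rule inj_onI, rule ccontr)
        fix x y assume xy: "x \<in> E" "y \<in> E" "h x = h y" "x \<noteq> y"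
        then obtain k where "dist ((T ^^ k) x) ((T ^^ k) y) > e"
          using E unfolding separated_set_def by blast
        moreover have "dist x y < d"
          using h[OF xy(1)] h[OF xy(2)] xy(3) by (metis dist_triangle_half_r)
        ultimately show False using near[of x y k] xy EX by force
      qed
      then show ?thesis using h C(1) by (intro card_inj_on_le[of h]) auto
    qed
    have bnds: "1 \<le> max_separated X T n e" "max_separated X T n e \<le> real (card C)" for n
    proof -
      let ?S = "{real (card E) | E. finite E \<and> separated_set X T n e E}"
      obtain x where "x \<in> X" using X by blast
      \<comment> \<open>Singletons are separated, so the supremum is over a nonempty set and its
        logarithm is nonnegative.\<close>
      then have "real (card {x}) \<in> ?S" by (intro CollectI exI[of _ "{x}"]) (auto simp: separated_set_def)
      moreover have le: "s \<le> real (card C)" if "s \<in> ?S" for s using that card_le by auto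
      moreover have "bdd_above ?S" using le by (rule bdd_aboveI)
      ultimately show "1 \<le> max_separated X T n e" "max_separated X T n e \<le> real (card C)"
        unfolding max_separated_def using cSup_upper[of "real (card {x})" ?S] cSup_least[of ?S "real (card C)"]
        by auto
    qed
    have "(\<lambda>n. ln (max_separated X T n e) / real n) \<longlonglongrightarrow> 0"
    proof (rule Lim_null_comparison)
      show "\<forall>\<^sub>F n in sequentially. norm (ln (max_separated X T n e) / real n) \<le> ln (real (card C)) / real n"
      proof (rule always_eventually, rule allI)
        fix n
        have "0 \<le> ln (max_separated X T n e)" "ln (max_separated X T n e) \<le> ln (real (card C))"
          using bnds[of n] by (auto simp: ln_ge_zero)
        then show "norm (ln (max_separated X T n e) / real n) \<le> ln (real (card C)) / real n"
          by (simp add: divide_right_mono)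
      qed
      show "(\<lambda>n. ln (real (card C)) / real n) \<longlonglongrightarrow> 0"
        by (rule lim_const_over_n)
    qed
    then have "(\<lambda>n. ereal (ln (max_separated X T n e) / real n)) \<longlonglongrightarrow> ereal 0"
      by simp
    then show ?thesis by (simp add: lim_imp_Limsup zero_ereal_def)
  qed
  then have "topological_entropy X T = (SUP e\<in>{0::real<..}. (0::ereal))"
    unfolding topological_entropy_def by (intro SUP_cong) auto
  then show ?thesis by simp
qed

section \<open>The shift on sequences dominated by \<tau>\<close>

theorem theorem2:
  fixes \<tau> :: "nat \<Rightarrow> real"
  assumes "decseq \<tau>" and "\<And>n. \<tau> n > 0" and "\<tau> \<longlonglongrightarrow> 0"
  shows "\<exists>(X :: (nat \<Rightarrow> real) set) T (f :: (nat \<Rightarrow> real) \<Rightarrow> real).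
    compact X \<and> T ` X \<subseteq> X \<and> continuous_on X T \<and>
    topological_entropy X T = 0 \<and> continuous_on X f \<and>
    (\<forall>a :: nat \<Rightarrow> real. (\<forall>n\<ge>1. \<bar>a n\<bar> \<le> 1) \<and>
        limsup (\<lambda>N. ereal ((\<Sum>n=1..N. \<bar>a n\<bar>) / real N)) > 0 \<longrightarrow>
        (\<exists>x\<in>X. limsup (\<lambda>N. ereal (((\<Sum>n=1..N. f ((T ^^ n) x) * a n) / real N) / \<tau> N)) > 0)) \<and>
    (\<forall>g :: (nat \<Rightarrow> real) \<Rightarrow> complex. continuous_on X g \<longrightarrow>
        (\<forall>x\<in>X. (\<lambda>N. (\<Sum>n=1..N. of_real (moebius n) * g ((T ^^ n) x)) / of_nat N) \<longlonglongrightarrow> 0))"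
proof -
  define X where "X = {x :: nat \<Rightarrow> real. \<forall>n. \<bar>x n\<bar> \<le> \<tau> n}"
  define T where "T = (\<lambda>(x :: nat \<Rightarrow> real) n. x (Suc n))"
  define f where "f = (\<lambda>x :: nat \<Rightarrow> real. x 0)"
  have T_pow: "(T ^^ k) x = (\<lambda>n. x (n + k))" for k x
    unfolding T_def by (rule shift_funpow)
  have X: "compact X" unfolding X_def by (rule compact_bounded_sequences)
  have X0: "(\<lambda>_. 0) \<in> X" using assms(2) by (simp add: X_def less_imp_le)
  have TX: "T ` X \<subseteq> X"
    using decseq_SucD[OF assms(1)] unfolding X_def T_def by (fastforce intro: order_trans)
  have contT: "continuous_on X T"
    unfolding T_def
    by (intro continuous_on_coordinatewise_then_product continuous_on_subset[OF continuous_on_product_coordinates]) auto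
  have contf: "continuous_on X f"
    unfolding f_def by (rule continuous_on_subset[OF continuous_on_product_coordinates]) auto
  \<comment> \<open>One factor 2 comes from the triangle inequality in each coordinate, the other
    from the total weight of the product metric.\<close>
  have dist_T: "dist ((T ^^ k) x) ((T ^^ k) y) \<le> 4 * \<tau> k" if "x \<in> X" "y \<in> X" for x y k
  proof -
    have "dist ((T ^^ k) x n) ((T ^^ k) y n) \<le> 2 * \<tau> k" for n
    proof -
      have "\<bar>x (n + k)\<bar> \<le> \<tau> (n + k)" "\<bar>y (n + k)\<bar> \<le> \<tau> (n + k)" "\<tau> (n + k) \<le> \<tau> k"
        using that decseqD[OF assms(1), of k "n + k"] by (auto simp: X_def)
      then show ?thesis by (simp add: T_pow dist_real_def)
    qed
    from dist_fun_le_of_coordinatewise[OF this] show ?thesis by simp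
  qed
  have dist_T_small: "\<exists>K. \<forall>k\<ge>K. \<forall>x\<in>X. \<forall>y\<in>X. dist ((T ^^ k) x) ((T ^^ k) y) \<le> e" if "e > 0" for e
  proof -
    obtain K where K: "\<And>k. k \<ge> K \<Longrightarrow> norm (\<tau> k - 0) < e / 4"
      using LIMSEQ_D[OF assms(3), of "e/4"] \<open>e > 0\<close> by (meson divide_pos_pos zero_less_numeral)
    show ?thesis
    proof (intro exI[of _ K] allI ballI impI)
      fix k x y assume "k \<ge> K" "x \<in> X" "y \<in> X"
      then show "dist ((T ^^ k) x) ((T ^^ k) y) \<le> e" using dist_T[of x y k] K[of k] by auto
    qed
  qed
  have entropy: "topological_entropy X T = 0"
    using X X0 contT TX dist_T_small by (intro topological_entropy_eq_0_if_contracting) auto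
  have slow: "\<exists>x\<in>X. limsup (\<lambda>N. ereal (((\<Sum>n=1..N. f ((T ^^ n) x) * a n) / real N) / \<tau> N)) > 0"
    if a: "limsup (\<lambda>N. ereal ((\<Sum>n=1..N. \<bar>a n\<bar>) / real N)) > 0" for a :: "nat \<Rightarrow> real"
  proof (intro bexI)
    let ?x = "\<lambda>n. \<tau> n * sgn (a n)"
    show "?x \<in> X" using assms(2) by (auto simp: X_def abs_mult abs_sgn_eq less_imp_le)
    have "(\<Sum>n=1..N. \<bar>a n\<bar>) / real N \<le> ((\<Sum>n=1..N. f ((T ^^ n) ?x) * a n) / real N) / \<tau> N" for N
    proof -
      have "\<tau> N * (\<Sum>n=1..N. \<bar>a n\<bar>) = (\<Sum>n=1..N. \<tau> N * \<bar>a n\<bar>)" by (simp add: sum_distrib_left)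
      \<comment> \<open>Monotonicity of \<tau> enters here: \<open>\<tau> N \<le> \<tau> n\<close>
        for all \<open>n \<le> N\<close>.\<close>
      also have "\<dots> \<le> (\<Sum>n=1..N. \<tau> n * \<bar>a n\<bar>)"
        using decseqD[OF assms(1)] by (intro sum_mono mult_right_mono) auto
      also have "\<dots> = (\<Sum>n=1..N. f ((T ^^ n) ?x) * a n)"
        by (intro sum.cong) (auto simp: f_def T_pow abs_sgn mult_ac)
      finally have "(\<Sum>n=1..N. \<bar>a n\<bar>) \<le> (\<Sum>n=1..N. f ((T ^^ n) ?x) * a n) / \<tau> N"
        using assms(2)[of N] by (simp add: field_simps)
      from divide_right_mono[OF this, of "real N"] show ?thesis by (simp add: mult.commute)
    qed
    then have "limsup (\<lambda>N. ereal ((\<Sum>n=1..N. \<bar>a n\<bar>) / real N))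
        \<le> limsup (\<lambda>N. ereal (((\<Sum>n=1..N. f ((T ^^ n) ?x) * a n) / real N) / \<tau> N))"
      by (intro Limsup_mono always_eventually) simp
    with a show "limsup (\<lambda>N. ereal (((\<Sum>n=1..N. f ((T ^^ n) ?x) * a n) / real N) / \<tau> N)) > 0"
      by order
  qed
  \<comment> \<open>Every orbit converges to the fixed point 0, so \<open>g\<close> along it
    converges to \<open>g\<close> at 0, and the mean of the Moebius function decides.\<close>
  have sarnak: "(\<lambda>N. (\<Sum>n=1..N. of_real (moebius n) * g ((T ^^ n) x)) / of_nat N) \<longlonglongrightarrow> 0"
    if g: "continuous_on X g" and x: "x \<in> X" for g :: "(nat \<Rightarrow> real) \<Rightarrow> complex" and x
  proof (rule cesaro_mean_mult_tendsto_0)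
    have TnX: "(T ^^ n) x \<in> X" for n
      using continuous_on_funpow[OF contT TX] x by blast
    have "(\<lambda>n. (T ^^ n) x) \<longlonglongrightarrow> (\<lambda>_. 0)"
    proof (rule metric_LIMSEQ_I)
      fix e :: real assume "e > 0"
      then obtain K where K: "\<forall>k\<ge>K. \<forall>x\<in>X. \<forall>y\<in>X. dist ((T ^^ k) x) ((T ^^ k) y) \<le> e / 2"
        using dist_T_small[of "e/2"] by auto
      have "dist ((T ^^ n) x) (\<lambda>_. 0) < e" if "n \<ge> K" for n
      proof -
        have "dist ((T ^^ n) x) ((T ^^ n) (\<lambda>_. 0)) \<le> e / 2" using K that x X0 by blast
        moreover have "(T ^^ n) (\<lambda>_. 0) = (\<lambda>_. 0)" by (simp add: T_pow)
        ultimately show ?thesis using \<open>e > 0\<close> by simp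
      qed
      then show "\<exists>no. \<forall>n\<ge>no. dist ((T ^^ n) x) (\<lambda>_. 0) < e" by blast
    qed
    then show "(\<lambda>n. g ((T ^^ n) x)) \<longlonglongrightarrow> g (\<lambda>_. 0)"
      by (rule continuous_on_tendsto_compose[OF g]) (use X0 TnX in auto)
    show "(\<lambda>N. (\<Sum>n=1..N. of_real (moebius n)) / of_nat N) \<longlonglongrightarrow> (0::complex)"
      using tendsto_of_real[OF moebius_mean_tendsto_0, where ?'a = complex] by simp
    show "norm (of_real (moebius n) :: complex) \<le> 1" for n
      using norm_moebius_le_1[of n] by simp
  qed
  show ?thesis
    using X TX contT entropy contf slow sarnak by (intro exI[of _ X] exI[of _ T] exI[of _ f]) blast
qed

end
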